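(* For $v,w\in W_{af}$ define $\psi^v(w)=\sum_{\varepsilon:\ |\varepsilon|=\ell(v),\ w^\varepsilon=v}\Psi^\varepsilon_\gamma\in\mathbb{Z}[\alpha_0,\dots,\alpha_{n-1}]$, where $\gamma$ is any (not necessarily minimal) alcove walk from $\mathbf{a}_0$ to $\mathbf{w}$ (this is independent of the choice of $\gamma$; an empty sum is $0$, and for $w=e$ one may take the trivial walk with the empty mask, giving $\psi^e(e)=1$). Then for all $v,w\in W_{af}$ and every $\beta\in R_{af}$, \[ \beta \ \text{ divides } \ \psi^v(w)-\psi^v(s_\beta w)\quad\text{in } \mathbb{Z}[\alpha_0,\dots,\alpha_{n-1}], \] where $s_\beta\in W_{af}$ is the reflection associated to $\beta$.
   Context: Let $(I_{af},A_{af})$ be an affine Cartan datum with generalized Cartan matrix $A_{af}=(a_{ij})$, $|I_{af}|=n$, $0\in I_{af}$, $I_0=I_{af}\setminus\{0\}$. The affine Weyl group $W_{af}$ is generated by $s_i$, $i\in I_{af}$, with relations $s_i^2=1$, $(s_is_j)^{m_{ij}}=1$ (where $m_{ij}=2,3,4,6$ according as $a_{ij}a_{ji}=0,1,2,3$); $\ell$ denotes Coxeter length. Simple affine roots $\alpha_i$ and coroots $\alpha_i^\vee$ satisfy $\langle\alpha_i^\vee,\alpha_j\rangle=a_{ij}$, and $W_{af}$ acts on the root lattice by $s_i\mu=\mu-\langle\alpha_i^\vee,\mu\rangle\alpha_i$. The real affine roots are $R_{af}=\{u\alpha_i: u\in W_{af}, i\in I_{af}\}$, with $R^+_{af}=R_{af}\cap\sum_i\mathbb{Z}_{\ge0}\alpha_i$,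 $R^-_{af}=-R^+_{af}$. For $\beta=u\alpha_i$, $s_\beta=us_iu^{-1}$. Let $R$ be the finite root system of $(I_0,A_0)$ with highest root $\theta$, and $\delta=\alpha_0+\theta$; then $R_{af}=\{\alpha+k\delta:\alpha\in R,k\in\mathbb{Z}\}$. Products of affine roots are regarded in $\mathbb{Z}[\alpha_0,\dots,\alpha_{n-1}]$ via $\delta=\alpha_0+\theta$. Geometry: $V^*=X^\vee\otimes\mathbb{R}$; $H_{\alpha+k\delta}=\{x:\langle x,\alpha\rangle=k\}$; $W_{af}$ acts on $V^*$ with $s_\beta$ the reflection across $H_\beta$. Alcoves are closures of components of the complement of all these hyperplanes; the base alcove $\mathbf{a}_0$ has walls $H_{\alpha_i}$, $i\in I_{af}$; $w\in W_{af}$ is identified with $\mathbf{w}=w\mathbf{a}_0$. The alcoves $u\mathbf{a}_0$ and $us_i\mathbf{a}_0$ share a panel of type $i$ lying in $H_{u\alpha_i}$. An alcove walk $\gamma=(\mathbf{a}_0,\dots,\mathbf{a}_m)$ is a sequence of alcoves, consecutive ones distinct and sharing a panel; if $\mathbf{a}_{j-1}=u\mathbf{a}_0$ and $\mathbf{a}_j=us_{i_j}\mathbf{a}_0$ then $\operatorname{type}(\gamma)=s_{i_1}\cdots s_{i_m}$ and $\gamma$ ends at $\mathbf{w}$ with $w=s_{i_1}\cdots s_{i_m}$. Step $j$ is forward if $\ell(u)<\ell(us_{i_j})$, backward otherwise, and is labelled by $\beta_j\in\{\pm u\alpha_{i_j}\}$ taken in $R^+_{af}$ for forward and $R^-_{af}$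 for backward steps. A mask is $\varepsilon\in\{0,1\}^m$, $|\varepsilon|$ its number of $1$'s, $w^\varepsilon=s_{i_1}^{\varepsilon_1}\cdots s_{i_m}^{\varepsilon_m}$, and $\Psi^\varepsilon_\gamma=\prod_{\varepsilon_j=1}\beta_j$ (empty product $1$). *)

theory Defs
  imports "HOL-Analysis.Analysis" "HOL-Algebra.Group" "HOL-Library.Poly_Mapping"
begin

section \<open>Generalized Cartan matrices, Weyl group, real roots\<close>

definition gcm :: "int^'n::finite^'n \<Rightarrow> bool" where
  "gcm A \<longleftrightarrow> (\<forall>i. A $ i $ i = 2) \<and> (\<forall>i j. i \<noteq> j \<longrightarrow> A $ i $ j \<le> 0) \<and>
     (\<forall>i j. A $ i $ j = 0 \<longrightarrow> A $ j $ i = 0)"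

definition indecomposable :: "int^'n::finite^'n \<Rightarrow> bool" where
  "indecomposable A \<longleftrightarrow>
     (\<forall>J. J \<noteq> {} \<and> J \<noteq> UNIV \<longrightarrow> (\<exists>i\<in>J. \<exists>j\<in>-J. A $ i $ j \<noteq> 0))"

text \<open>Kac, Infinite dimensional Lie algebras, Theorem 4.3 (Aff), for an indecomposable matrix.\<close>

definition affine_type :: "int^'n::finite^'n \<Rightarrow> bool" where
  "affine_type A \<longleftrightarrow>
     (let B = (\<chi> i j. real_of_int (A $ i $ j)) :: real^'n^'n in
        rank B + 1 = CARD('n) \<and>
        (\<exists>u. (\<forall>i. u $ i > 0) \<and> B *v u = 0) \<and>
        (\<forall>v. (\<forall>i. (B *v v) $ i \<ge> 0) \<longrightarrow> B *v v = 0))"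

text \<open>The exponent \<open>0\<close> encodes \<open>m\<^sub>i\<^sub>j = \<infinity>\<close>: it yields the trivial relation. This is the case
  \<open>a\<^sub>i\<^sub>j a\<^sub>j\<^sub>i = 4\<close>, which occurs in type \<open>A\<^sub>1\<close> affine; for \<open>i = j\<close> the relation \<open>s\<^sub>i\<^sup>2 = 1\<close> is
  imposed separately below.\<close>

definition cox_exp :: "int^'n::finite^'n \<Rightarrow> 'n \<Rightarrow> 'n \<Rightarrow> nat" where
  "cox_exp A i j =
     (let p = A $ i $ j * A $ j $ i in
      if p = 0 then 2 else if p = 1 then 3 else if p = 2 then 4 else if p = 3 then 6 else 0)"

definition relators :: "int^'n::finite^'n \<Rightarrow> 'n list set" where
  "relators A = {[i, i] | i. True} \<union> {concat (replicate (cox_exp A i j) [i, j]) | i j. True}"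

definition delete_relator :: "int^'n::finite^'n \<Rightarrow> 'n list \<Rightarrow> 'n list \<Rightarrow> bool" where
  "delete_relator A x y \<longleftrightarrow> (\<exists>p r q. r \<in> relators A \<and> x = p @ r @ q \<and> y = p @ q)"

definition word_eq :: "int^'n::finite^'n \<Rightarrow> ('n list \<times> 'n list) set" where
  "word_eq A = {(x, y). equivclp (delete_relator A) x y}"

text \<open>The group presented by the \<open>s\<^sub>i\<close> and the above relations. No formal inverses of letters
  are needed since \<open>s\<^sub>i\<^sup>2 = 1\<close>. An element is the set of all words representing it.\<close>

definition weyl_group :: "int^'n::finite^'n \<Rightarrow> 'n list set monoid" where
  "weyl_group A =
     \<lparr>carrier = UNIV // word_eq A,
      mult = (\<lambda>X Y. \<Union>x\<in>X. \<Union>y\<in>Y. word_eq A `` {x @ y}),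
      one = word_eq A `` {[]}\<rparr>"

lemma equiv_word_eq: "equiv UNIV (word_eq A)"
  by (auto simp: word_eq_def equiv_def refl_on_def sym_def trans_def
      intro: equivclp_sym equivclp_trans)

lemma delete_relator_context:
  assumes "delete_relator A x y" shows "delete_relator A (p @ x @ q) (p @ y @ q)"
proof -
  obtain a r b where "r \<in> relators A" "x = a @ r @ b" "y = a @ b"
    using assms unfolding delete_relator_def by blast
  then have "p @ x @ q = (p @ a) @ r @ (b @ q)" "p @ y @ q = (p @ a) @ (b @ q)" by auto
  with \<open>r \<in> relators A\<close> show ?thesis unfolding delete_relator_def by blast
qed

lemma word_eq_context: "(x, y) \<in> word_eq A \<Longrightarrow> (p @ x @ q, p @ y @ q) \<in> word_eq A"
proof -
  assume "(x, y) \<in> word_eq A"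
  then have "equivclp (delete_relator A) x y" by (simp add: word_eq_def)
  then have "equivclp (delete_relator A) (p @ x @ q) (p @ y @ q)"
  proof (induction rule: equivclp_induct)
    case base then show ?case by simp
  next
    case (step y z)
    then have "equivclp (delete_relator A) (p @ y @ q) (p @ z @ q)"
      using step.hyps delete_relator_context[of A y z p q] delete_relator_context[of A z y p q]
      by (auto intro: r_into_equivclp converse_r_into_equivclp)
    with step.IH show ?case by (rule equivclp_trans)
  qed
  then show ?thesis by (simp add: word_eq_def)
qed

lemma word_eq_append:
  assumes "(x, x') \<in> word_eq A" "(y, y') \<in> word_eq A"
  shows "(x @ y, x' @ y') \<in> word_eq A"
proof -
  have "(x @ y, x' @ y) \<in> word_eq A" "(x' @ y, x' @ y') \<in> word_eq A"
    using word_eq_context[OF assms(1), of "[]" y] word_eq_context[OF assms(2), of x' "[]"] by auto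
  then show ?thesis using equiv_word_eq[of A] by (meson equivE transD)
qed

lemma weyl_mult_class:
  "word_eq A `` {x} \<otimes>\<^bsub>weyl_group A\<^esub> word_eq A `` {y} = word_eq A `` {x @ y}"
proof -
  have "word_eq A `` {x' @ y'} = word_eq A `` {x @ y}"
    if "x' \<in> word_eq A `` {x}" "y' \<in> word_eq A `` {y}" for x' y'
    using that by (intro equiv_class_eq[OF equiv_word_eq, symmetric] word_eq_append) auto
  moreover have "x \<in> word_eq A `` {x}" "y \<in> word_eq A `` {y}"
    using equiv_word_eq[of A] by (auto simp: equiv_def refl_on_def)
  ultimately have "(\<Union>x'\<in>word_eq A `` {x}. \<Union>y'\<in>word_eq A `` {y}. word_eq A `` {x' @ y'}) =
      word_eq A `` {x @ y}" by blast
  then show ?thesis by (simp add: weyl_group_def)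
qed

lemma word_rev: "(rev x @ x, []) \<in> word_eq A"
proof (induction x)
  case Nil then show ?case by (simp add: word_eq_def)
next
  case (Cons i x)
  have "delete_relator A (rev x @ [i, i] @ x) (rev x @ x)"
    unfolding delete_relator_def relators_def by blast
  then have "(rev x @ [i, i] @ x, rev x @ x) \<in> word_eq A"
    by (simp add: word_eq_def r_into_equivclp)
  with Cons.IH show ?case using equiv_word_eq[of A] by (auto simp: equiv_def dest: transD)
qed

lemma group_weyl_group: "group (weyl_group A)"
proof -
  have c: "X \<in> carrier (weyl_group A) \<longleftrightarrow> (\<exists>x. X = word_eq A `` {x})" for X
    by (auto simp: weyl_group_def quotient_def)
  have o: "\<one>\<^bsub>weyl_group A\<^esub> = word_eq A `` {[]}" by (simp add: weyl_group_def)
  have i: "word_eq A `` {rev x @ x} = word_eq A `` {[]}" for x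
    by (rule equiv_class_eq[OF equiv_word_eq word_rev])
  show ?thesis
  proof (rule groupI)
    fix X assume "X \<in> carrier (weyl_group A)"
    then obtain x where "X = word_eq A `` {x}" using c by blast
    then show "\<exists>Y\<in>carrier (weyl_group A). Y \<otimes>\<^bsub>weyl_group A\<^esub> X = \<one>\<^bsub>weyl_group A\<^esub>"
      using c o i weyl_mult_class by (intro bexI[of _ "word_eq A `` {rev x}"]) (auto simp: weyl_mult_class)
  qed (auto simp: c o weyl_mult_class)
qed

definition gen :: "int^'n::finite^'n \<Rightarrow> 'n \<Rightarrow> 'n list set" where
  "gen A i = word_eq A `` {[i]}"

definition len :: "'n list set \<Rightarrow> nat" where
  "len u = (LEAST k. \<exists>x\<in>u. length x = k)"

text \<open>The root lattice is \<open>int^'n\<close>, with \<open>\<alpha>\<^sub>i = axis i 1\<close> and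
  \<open>\<langle>\<alpha>\<^sub>i\<^sup>\<or>, \<mu>\<rangle> = (A *v \<mu>) $ i\<close>.\<close>

abbreviation simple_root :: "'n::finite \<Rightarrow> int^'n" where
  "simple_root i \<equiv> axis i 1"

definition simple_refl :: "int^'n::finite^'n \<Rightarrow> 'n \<Rightarrow> int^'n \<Rightarrow> int^'n" where
  "simple_refl A i \<mu> = \<mu> - ((A *v \<mu>) $ i) *s simple_root i"

text \<open>For a generalized Cartan matrix all words in \<open>u\<close> act in the same way, so that the set below
  is a singleton; likewise for \<open>geom_act\<close>.\<close>

definition act :: "int^'n::finite^'n \<Rightarrow> 'n list set \<Rightarrow> int^'n \<Rightarrow> int^'n" where
  "act A u \<mu> = the_elem ((\<lambda>x. foldr (simple_refl A) x \<mu>) ` u)"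

definition real_roots :: "int^'n::finite^'n \<Rightarrow> (int^'n) set" where
  "real_roots A = {act A u (simple_root i) | u i. u \<in> carrier (weyl_group A)}"

definition pos_roots :: "int^'n::finite^'n \<Rightarrow> (int^'n) set" where
  "pos_roots A = {\<beta> \<in> real_roots A. \<forall>i. 0 \<le> \<beta> $ i}"

definition neg_roots :: "int^'n::finite^'n \<Rightarrow> (int^'n) set" where
  "neg_roots A = uminus ` pos_roots A"

definition reflection :: "int^'n::finite^'n \<Rightarrow> int^'n \<Rightarrow> 'n list set" where
  "reflection A \<beta> = (THE r. \<exists>u i. u \<in> carrier (weyl_group A) \<and> \<beta> = act A u (simple_root i) \<and>
     r = u \<otimes>\<^bsub>weyl_group A\<^esub> gen A i \<otimes>\<^bsub>weyl_group A\<^esub> inv\<^bsub>weyl_group A\<^esub> u)"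


section \<open>Affine Cartan data\<close>

text \<open>The index set is \<open>I\<^sub>a\<^sub>f = 'i option\<close>, with \<open>None\<close> the affine node \<open>0\<close> and
  \<open>I\<^sub>0\<close> the range of \<open>Some\<close>.\<close>

definition fin_matrix :: "int^('i::finite option)^('i option) \<Rightarrow> int^'i^'i" where
  "fin_matrix A = (\<chi> i j. A $ Some i $ Some j)"

definition highest_root :: "int^'i::finite^'i \<Rightarrow> int^'i \<Rightarrow> bool" where
  "highest_root A\<^sub>0 \<theta> \<longleftrightarrow>
     \<theta> \<in> real_roots A\<^sub>0 \<and> (\<forall>\<beta>\<in>real_roots A\<^sub>0. \<forall>i. \<beta> $ i \<le> \<theta> $ i)"

definition delta :: "int^'i::finite \<Rightarrow> int^('i option)" where
  "delta \<theta> = (\<chi> k. case k of None \<Rightarrow> 1 | Some i \<Rightarrow> \<theta> $ i)"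

text \<open>That \<open>\<delta> = \<alpha>\<^sub>0 + \<theta>\<close> is the null root, with \<open>\<theta>\<close> the highest root of \<open>A\<^sub>0\<close>, amounts to
  the datum being untwisted; this is what makes \<open>R\<^sub>a\<^sub>f = {\<alpha> + k \<delta>. \<alpha> \<in> R}\<close>.\<close>

definition affine_cartan_datum :: "int^('i::finite option)^('i option) \<Rightarrow> int^'i \<Rightarrow> bool" where
  "affine_cartan_datum A \<theta> \<longleftrightarrow>
     gcm A \<and> indecomposable A \<and> affine_type A \<and>
     highest_root (fin_matrix A) \<theta> \<and> A *v delta \<theta> = 0"

text \<open>\<open>\<beta> = fin_part \<theta> \<beta> + level \<beta> \<cdot> \<delta>\<close>, with the finite part in the root lattice of \<open>A\<^sub>0\<close>.\<close>

definition level :: "int^('i::finite option) \<Rightarrow> int" where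
  "level \<beta> = \<beta> $ None"

definition fin_part :: "int^'i::finite \<Rightarrow> int^('i option) \<Rightarrow> int^'i" where
  "fin_part \<theta> \<beta> = (\<chi> j. \<beta> $ Some j - level \<beta> * \<theta> $ j)"


section \<open>Alcoves\<close>

text \<open>\<open>V\<^sup>*\<close> is \<open>real^'i\<close> in the basis dual to the simple roots of \<open>A\<^sub>0\<close>: \<open>x $ j = \<langle>x, \<alpha>\<^sub>j\<rangle>\<close>.\<close>

definition pairing :: "real^'i::finite \<Rightarrow> int^'i \<Rightarrow> real" where
  "pairing x \<alpha> = (\<Sum>j\<in>UNIV. x $ j * real_of_int (\<alpha> $ j))"

definition hyperpl :: "int^'i::finite \<Rightarrow> int^('i option) \<Rightarrow> (real^'i) set" where
  "hyperpl \<theta> \<beta> = {x. pairing x (fin_part \<theta> \<beta>) = real_of_int (level \<beta>)}"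

text \<open>In the chosen coordinates \<open>\<alpha>\<^sub>i\<^sup>\<or>\<close> is \<open>(a\<^sub>i\<^sub>j)\<^sub>j\<close>. For \<open>i = None\<close> this is \<open>- \<theta>\<^sup>\<or>\<close>, the coroot of
  the finite part \<open>- \<theta>\<close> of \<open>\<alpha>\<^sub>0 = - \<theta> + \<delta>\<close>, since \<open>a\<^sub>0\<^sub>j = - \<langle>\<theta>\<^sup>\<or>, \<alpha>\<^sub>j\<rangle>\<close>.\<close>

definition simple_coroot :: "int^('i::finite option)^('i option) \<Rightarrow> 'i option \<Rightarrow> real^'i" where
  "simple_coroot A i = (\<chi> j. real_of_int (A $ i $ Some j))"

definition geom_refl ::
  "int^('i::finite option)^('i option) \<Rightarrow> int^'i \<Rightarrow> 'i option \<Rightarrow> real^'i \<Rightarrow> real^'i" where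
  "geom_refl A \<theta> i x =
     x - (pairing x (fin_part \<theta> (simple_root i)) - real_of_int (level (simple_root i)))
           *\<^sub>R simple_coroot A i"

definition geom_act ::
  "int^('i::finite option)^('i option) \<Rightarrow> int^'i \<Rightarrow> 'i option list set \<Rightarrow> real^'i \<Rightarrow> real^'i" where
  "geom_act A \<theta> u x = the_elem ((\<lambda>k. foldr (geom_refl A \<theta>) k x) ` u)"

definition alcoves ::
  "int^('i::finite option)^('i option) \<Rightarrow> int^'i \<Rightarrow> (real^'i) set set" where
  "alcoves A \<theta> = closure ` components (- (\<Union>\<beta>\<in>real_roots A. hyperpl \<theta> \<beta>))"

text \<open>With \<open>H\<close> at \<open>\<alpha> + k \<delta>\<close> given by \<open>\<langle>x, \<alpha>\<rangle> = k\<close>, the hyperplanes of the simple affine roots are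
  \<open>\<langle>x, \<alpha>\<^sub>i\<rangle> = 0\<close> and \<open>\<langle>x, \<theta>\<rangle> = -1\<close>, so the alcove having these as walls is the simplex
  \<open>\<langle>x, \<alpha>\<^sub>i\<rangle> \<le> 0\<close>, \<open>\<langle>x, \<theta>\<rangle> \<ge> -1\<close>.\<close>

definition base_alcove :: "int^'i::finite \<Rightarrow> (real^'i) set" where
  "base_alcove \<theta> =
     {x. \<forall>i. pairing x (fin_part \<theta> (simple_root i)) \<le> real_of_int (level (simple_root i))}"

definition alcove_of ::
  "int^('i::finite option)^('i option) \<Rightarrow> int^'i \<Rightarrow> 'i option list set \<Rightarrow> (real^'i) set" where
  "alcove_of A \<theta> u = geom_act A \<theta> u ` base_alcove \<theta>"

definition elt_of ::
  "int^('i::finite option)^('i option) \<Rightarrow> int^'i \<Rightarrow> (real^'i) set \<Rightarrow> 'i option list set" where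
  "elt_of A \<theta> a = (THE u. u \<in> carrier (weyl_group A) \<and> alcove_of A \<theta> u = a)"


section \<open>Alcove walks\<close>

text \<open>\<open>alcove_walk A \<theta> \<gamma> ks w\<close>: \<open>\<gamma>\<close> is an alcove walk from the base alcove to \<open>w\<close>, of type
  given by the word \<open>ks\<close>. Panels are the facets of an alcove.\<close>

definition alcove_walk ::
  "int^('i::finite option)^('i option) \<Rightarrow> int^'i \<Rightarrow> (real^'i) set list \<Rightarrow> 'i option list \<Rightarrow>
     'i option list set \<Rightarrow> bool" where
  "alcove_walk A \<theta> \<gamma> ks w \<longleftrightarrow>
     length \<gamma> = length ks + 1 \<and> set \<gamma> \<subseteq> alcoves A \<theta> \<and>
     \<gamma> ! 0 = base_alcove \<theta> \<and> \<gamma> ! length ks = alcove_of A \<theta> w \<and>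
     (\<forall>j<length ks. \<gamma> ! j \<noteq> \<gamma> ! Suc j \<and>
        (\<exists>F. F facet_of (\<gamma> ! j) \<and> F facet_of (\<gamma> ! Suc j))) \<and>
     (\<forall>j<length ks. \<exists>u\<in>carrier (weyl_group A).
        \<gamma> ! j = alcove_of A \<theta> u \<and>
        \<gamma> ! Suc j = alcove_of A \<theta> (u \<otimes>\<^bsub>weyl_group A\<^esub> gen A (ks ! j)))"

definition step_label ::
  "int^('i::finite option)^('i option) \<Rightarrow> int^'i \<Rightarrow> (real^'i) set list \<Rightarrow> 'i option list \<Rightarrow>
     nat \<Rightarrow> int^('i option)" where
  "step_label A \<theta> \<gamma> ks j =
     (let u = elt_of A \<theta> (\<gamma> ! j);
          \<beta> = act A u (simple_root (ks ! j))
      in if len u < len (u \<otimes>\<^bsub>weyl_group A\<^esub> gen A (ks ! j))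
         then (if \<beta> \<in> pos_roots A then \<beta> else - \<beta>)
         else (if \<beta> \<in> neg_roots A then \<beta> else - \<beta>))"

definition subword_elt ::
  "int^'n::finite^'n \<Rightarrow> 'n list \<Rightarrow> bool list \<Rightarrow> 'n list set" where
  "subword_elt A ks \<epsilon> =
     foldr (\<otimes>\<^bsub>weyl_group A\<^esub>)
       (map2 (\<lambda>i e. if e then gen A i else \<one>\<^bsub>weyl_group A\<^esub>) ks \<epsilon>) \<one>\<^bsub>weyl_group A\<^esub>"


section \<open>The polynomials \<open>\<psi>\<close>\<close>

text \<open>Multivariate integer polynomials in variables indexed by \<open>'n\<close>.\<close>

type_synonym 'n mpol = "('n \<Rightarrow>\<^sub>0 nat) \<Rightarrow>\<^sub>0 int"

definition root_pol :: "int^'n::finite \<Rightarrow> 'n mpol" where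
  "root_pol \<beta> = (\<Sum>i\<in>UNIV. Poly_Mapping.single (Poly_Mapping.single i 1) (\<beta> $ i))"

definition mask_pol ::
  "int^('i::finite option)^('i option) \<Rightarrow> int^'i \<Rightarrow> (real^'i) set list \<Rightarrow> 'i option list \<Rightarrow>
     bool list \<Rightarrow> 'i option mpol" where
  "mask_pol A \<theta> \<gamma> ks \<epsilon> =
     (\<Prod>j\<in>{j. j < length ks \<and> \<epsilon> ! j}. root_pol (step_label A \<theta> \<gamma> ks j))"

definition psi_walk ::
  "int^('i::finite option)^('i option) \<Rightarrow> int^'i \<Rightarrow> 'i option list set \<Rightarrow>
     (real^'i) set list \<Rightarrow> 'i option list \<Rightarrow> 'i option mpol" where
  "psi_walk A \<theta> v \<gamma> ks =
     (\<Sum>\<epsilon>\<in>{\<epsilon>. length \<epsilon> = length ks \<and> count_list \<epsilon> True = len v \<and> subword_elt A ks \<epsilon> = v}.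
        mask_pol A \<theta> \<gamma> ks \<epsilon>)"

text \<open>An arbitrary walk to \<open>w\<close> is chosen; that the choice does not matter is part of the theorem.\<close>

definition psi ::
  "int^('i::finite option)^('i option) \<Rightarrow> int^'i \<Rightarrow> 'i option list set \<Rightarrow>
     'i option list set \<Rightarrow> 'i option mpol" where
  "psi A \<theta> v w =
     (case SOME (\<gamma>, ks). alcove_walk A \<theta> \<gamma> ks w of (\<gamma>, ks) \<Rightarrow> psi_walk A \<theta> v \<gamma> ks)"

end

theory Submission
  imports Defs
begin

text \<open>By the positivity theorem \<open>\<ell>(u s\<^sub>i) > \<ell>(u) \<longleftrightarrow> u \<alpha>\<^sub>i > 0\<close>, proved by induction on length with
  a reduction to dihedral subgroups, the label of a step from \<open>u\<close> to \<open>u s\<^sub>i\<close> is always \<open>u \<alpha>\<^sub>i\<close>, whatever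
  its direction, and alcoves correspond bijectively to group elements. Hence \<open>\<psi>\<close> is a function of
  the word \<open>i\<^sub>1 \<dots> i\<^sub>m\<close> of the walk, namely the product of the factors \<open>1 + \<beta>\<^sub>j U\<^sub>j\<close>, where \<open>(U\<^sub>j f)(v)\<close>
  is \<open>f(v s)\<close> if the simple reflection \<open>s\<close> of step \<open>j\<close> shortens \<open>v\<close>, and \<open>0\<close> otherwise; these operators
  satisfy the nil-Coxeter relations. Invariance under \<open>s\<^sub>i\<^sup>2 = 1\<close> is \<open>(1 - \<beta> U) (1 + \<beta> U) = 1\<close>, and
  invariance under the braid relations is the Yang--Baxter equation in rank two. For the divisibility
  let \<open>\<beta> = u \<alpha>\<^sub>i\<close> and compare the words \<open>u q\<close> and \<open>u i q\<close>: the additional factor \<open>1 + \<beta> U\<close> and all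
  differences of the labels along \<open>q\<close> vanish modulo \<open>\<beta>\<close>.\<close>

section \<open>Words and length\<close>

locale weyl_words =
  fixes A :: "int^'n::finite^'n"
begin

definition cl :: "'n list \<Rightarrow> 'n list set" where
  "cl x = word_eq A `` {x}"

abbreviation L :: "'n list \<Rightarrow> nat" where
  "L x \<equiv> len (cl x)"

lemma cl_eq_iff: "cl x = cl y \<longleftrightarrow> (x, y) \<in> word_eq A"
  by (simp add: cl_def eq_equiv_class_iff[OF equiv_word_eq])

lemma mem_cl_iff: "y \<in> cl x \<longleftrightarrow> cl y = cl x"
  using cl_eq_iff[of x y] by (auto simp: cl_def)

lemma cl_append_cong: "cl x = cl x' \<Longrightarrow> cl y = cl y' \<Longrightarrow> cl (x @ y) = cl (x' @ y')"
  by (simp add: cl_eq_iff word_eq_append)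

lemma cl_relator: "r \<in> relators A \<Longrightarrow> cl (p @ r @ q) = cl (p @ q)"
  unfolding cl_eq_iff word_eq_def mem_Collect_eq prod.case
  by (rule r_into_equivclp) (auto simp: delete_relator_def)

lemma cl_double: "cl (p @ i # i # q) = cl (p @ q)"
  using cl_relator[of "[i, i]" p q] by (auto simp: relators_def)

lemma cl_rev_append: "cl (rev x @ x) = cl []" "cl (x @ rev x) = cl []"
  using word_rev[of x A] word_rev[of "rev x" A] by (simp_all add: cl_eq_iff)

lemma cl_cancel_right: "cl (x @ z) = cl (y @ z) \<Longrightarrow> cl x = cl y"
  using cl_append_cong[of "x @ z" "y @ z" "rev z" "rev z"]
    cl_append_cong[OF refl cl_rev_append(2), of x z] cl_append_cong[OF refl cl_rev_append(2), of y z]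
  by simp

lemma cl_cancel_left: "cl (z @ x) = cl (z @ y) \<Longrightarrow> cl x = cl y"
  using cl_append_cong[of "rev z" "rev z" "z @ x" "z @ y"]
    cl_append_cong[OF cl_rev_append(1) refl, of z x] cl_append_cong[OF cl_rev_append(1) refl, of z y]
  by simp

lemma cl_append_single: "cl (x @ [i]) = cl y \<longleftrightarrow> cl x = cl (y @ [i])"
  using cl_double[of x i "[]"] cl_double[of y i "[]"] cl_append_cong[of "x @ [i]" y "[i]" "[i]"]
    cl_append_cong[of x "y @ [i]" "[i]" "[i]"] by auto

text \<open>Equal classes are joined by a chain of relator deletions and insertions, so a single
  deletion suffices. The parity of the length, the action and the mask sums all descend from words
  to the group in this way.\<close>

lemma word_invariant:
  assumes "\<And>p r q. r \<in> relators A \<Longrightarrow> f (p @ r @ q) = f (p @ q)" and "cl x = cl y"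
  shows "f x = f y"
proof -
  have "equivclp (delete_relator A) x y" using assms(2) by (simp add: cl_eq_iff word_eq_def)
  then show ?thesis
    by (induction rule: equivclp_induct) (auto simp: delete_relator_def assms(1))
qed

lemma ex_reduced: "\<exists>y. cl y = cl x \<and> length y = L x"
proof -
  have "\<exists>k. \<exists>y\<in>cl x. length y = k" using mem_cl_iff by blast
  from LeastI_ex[OF this] show ?thesis unfolding len_def using mem_cl_iff by blast
qed

lemma L_le: "cl y = cl x \<Longrightarrow> L x \<le> length y"
  unfolding len_def using mem_cl_iff by (intro Least_le) blast

lemma L_le_length: "L x \<le> length x"
  by (rule L_le) simp

lemma L_append: "L (x @ y) \<le> L x + L y"
proof -
  obtain x' y' where "cl x' = cl x" "length x' = L x" "cl y' = cl y" "length y' = L y"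
    using ex_reduced by meson
  then show ?thesis using L_le[of "x' @ y'" "x @ y"] cl_append_cong[of x' x y' y] by simp
qed

lemma parity_invariant: "cl x = cl y \<Longrightarrow> even (length x) \<longleftrightarrow> even (length y)"
proof (rule word_invariant[of "\<lambda>x. even (length x)"])
  have "even (length (concat (replicate n [i, j])))" for n and i j :: 'n
    by (induction n) auto
  then show "even (length (p @ r @ q)) = even (length (p @ q))" if "r \<in> relators A" for p r q
    using that by (auto simp: relators_def)
qed

lemma even_L: "even (L x) \<longleftrightarrow> even (length x)"
  using ex_reduced[of x] parity_invariant by metis

text \<open>Subadditivity bounds the change by one, and parity excludes equality.\<close>

lemma L_snoc_cases:
  obtains "L (x @ [i]) = Suc (L x)" | "L x = Suc (L (x @ [i]))"
proof -
  have "L (x @ [i]) \<le> Suc (L x)" using L_append[of x "[i]"] L_le_length[of "[i]"] by simp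
  moreover have "L x \<le> Suc (L (x @ [i]))"
    using L_append[of "x @ [i]" "[i]"] L_le_length[of "[i]"] cl_double[of x i "[]"] by simp
  moreover have "L (x @ [i]) \<noteq> L x" using even_L[of x] even_L[of "x @ [i]"] by auto
  ultimately show ?thesis using that by linarith
qed

lemma L_eq_0: "L x = 0 \<Longrightarrow> cl x = cl []"
  using ex_reduced[of x] by auto

end

section \<open>Alternating words and braid relations\<close>

fun alt :: "'a \<Rightarrow> 'a \<Rightarrow> nat \<Rightarrow> 'a list" where
  "alt i j 0 = []"
| "alt i j (Suc k) = i # alt j i k"

lemma length_alt [simp]: "length (alt i j k) = k"
  by (induction k arbitrary: i j) auto

lemma alt_add: "alt i j (k + l) = alt i j k @ (if even k then alt i j l else alt j i l)"
  by (induction k arbitrary: i j) auto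

lemma alt_snoc: "alt i j (Suc k) = alt i j k @ [if even k then i else j]"
  using alt_add[of i j k 1] by simp

lemma alt_prefix: "\<exists>z. alt i j (k + l) = alt i j k @ z \<and> length z = l"
  using alt_add[of i j k l] by auto

lemma rev_alt: "rev (alt i j k) = (if even k then alt j i k else alt i j k)"
proof (induction k)
  case (Suc k)
  have "rev (alt i j (Suc k)) = (if even k then i else j) # rev (alt i j k)"
    by (simp add: alt_snoc del: alt.simps)
  with Suc show ?case by simp
qed simp

text \<open>The relator is one alternating word times the inverse of the other, which is how it
  becomes a braid relation.\<close>

lemma concat_replicate_alt: "concat (replicate n [i, j]) = alt i j n @ rev (alt j i n)"
proof -
  have "concat (replicate n [i, j]) = alt i j (n + n)"
    by (induction n) auto
  then show ?thesis by (simp add: alt_add rev_alt)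
qed

lemma alternating_eq_alt:
  assumes "set d \<subseteq> {s, t}" "\<And>p i q. d \<noteq> p @ [i, i] @ q" "d \<noteq> []" "last d = s"
  shows "\<exists>k. d = rev (alt s t k)"
proof -
  \<comment> \<open>A two-letter word without equal neighbours is determined by its first letter and
    its length. This is applied to \<open>rev d\<close>, which starts with \<open>s\<close>.\<close>
  have alt: "c = alt (hd c) (if hd c = s then t else s) (length c)"
    if "set c \<subseteq> {s, t}" "\<And>p i q. c \<noteq> p @ [i, i] @ q" "c \<noteq> []" for c
    using that
  proof (induction c)
    case (Cons a c)
    show ?case
    proof (cases c)
      case (Cons b e)
      have "c \<noteq> p @ [i, i] @ q" for p i q using Cons.prems(2)[of "a # p" i q] by auto
      moreover have "a \<noteq> b" using Cons.prems(2)[of "[]" a e] Cons by auto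
      ultimately show ?thesis using Cons.IH Cons.prems(1) Cons by (auto split: if_splits)
    qed simp
  qed simp
  have "rev d \<noteq> p @ [i, i] @ q" for p i q
  proof
    assume "rev d = p @ [i, i] @ q"
    then have "d = rev q @ [i, i] @ rev p"
      by (metis append.assoc rev.simps rev_append rev_rev_ident append_Nil append_Cons)
    then show False using assms(2) by blast
  qed
  moreover have "hd (rev d) = s" using assms(3,4) by (simp add: hd_rev)
  ultimately have "rev d = alt s t (length d)"
    using alt[of "rev d"] assms(1,3) by simp
  then show ?thesis by (metis rev_rev_ident)
qed

lemma (in weyl_words) cl_braid:
  assumes "cox_exp A i j > 0"
  shows "cl (alt i j (cox_exp A i j)) = cl (alt j i (cox_exp A i j))"
proof -
  let ?m = "cox_exp A i j"
  have "cl (alt i j ?m @ rev (alt j i ?m)) = cl []"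
  proof -
    have "concat (replicate ?m [i, j]) \<in> relators A" unfolding relators_def by blast
    from cl_relator[OF this, of "[]" "[]"] show ?thesis by (simp add: concat_replicate_alt)
  qed
  also have "\<dots> = cl (alt j i ?m @ rev (alt j i ?m))"
    using cl_rev_append by blast
  finally show ?thesis by (rule cl_cancel_right)
qed

section \<open>The action on the root lattice\<close>

locale gcm_words = weyl_words A for A :: "int^'n::finite^'n" +
  assumes gcm: "gcm A"
begin

abbreviation R :: "'n list \<Rightarrow> int^'n \<Rightarrow> int^'n" where
  "R x \<equiv> foldr (simple_refl A) x"

lemma diag: "A $ i $ i = 2" and off_diag: "i \<noteq> j \<Longrightarrow> A $ i $ j \<le> 0"
  and sym_zero: "A $ i $ j = 0 \<Longrightarrow> A $ j $ i = 0"
  using gcm by (auto simp: gcm_def)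

lemma coroot_simple: "(A *v axis j 1) $ i = A $ i $ j"
  by (simp add: matrix_vector_mult_def axis_def if_distrib cong: if_cong)

lemma mult_scale: "A *v (c *s \<mu>) = c *s (A *v \<mu>)"
  by (simp add: vec_eq_iff matrix_vector_mult_def sum_distrib_left algebra_simps)

lemma refl_add: "simple_refl A i (\<mu> + \<nu>) = simple_refl A i \<mu> + simple_refl A i \<nu>"
  by (simp add: simple_refl_def matrix_vector_right_distrib vec_eq_iff algebra_simps)

lemma refl_scale: "simple_refl A i (c *s \<mu>) = c *s simple_refl A i \<mu>"
  by (simp add: simple_refl_def mult_scale vec_eq_iff algebra_simps)

lemma R_add: "R x (\<mu> + \<nu>) = R x \<mu> + R x \<nu>"
  by (induction x) (auto simp: refl_add)

lemma R_scale: "R x (c *s \<mu>) = c *s R x \<mu>"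
  by (induction x) (auto simp: refl_scale)

lemma R_minus: "R x (- \<mu>) = - R x \<mu>"
proof -
  have "(- 1) *s \<nu> = - \<nu>" for \<nu> :: "int^'n" by (simp add: vec_eq_iff)
  then show ?thesis using R_scale[of x "-1" \<mu>] by simp
qed

lemma R_diff: "R x (\<mu> - \<nu>) = R x \<mu> - R x \<nu>"
  using R_add[of x \<mu> "- \<nu>"] by (simp add: R_minus)

lemma R_zero: "R x 0 = 0"
  using R_add[of x 0 0] by simp

lemma simple_refl_simple: "simple_refl A i (axis j 1) = axis j 1 - (A $ i $ j) *s axis i 1"
  by (simp add: simple_refl_def coroot_simple)

lemma simple_refl_self: "simple_refl A i (axis i 1) = - axis i 1"
  by (simp add: simple_refl_simple diag vec_eq_iff)

lemma refl_refl: "simple_refl A i (simple_refl A i \<mu>) = \<mu>"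
  by (simp add: simple_refl_def matrix_vector_mult_diff_distrib mult_scale coroot_simple
      diag vec_eq_iff algebra_simps)

text \<open>Both reflections preserve the translate by \<open>\<mu>\<close> of the span of the two
  simple roots, so the dihedral relations become computations with two integer coefficients.\<close>

lemma refl_dihedral:
  "simple_refl A i (\<mu> + x *s axis i 1 + y *s axis j 1) =
    \<mu> + (- x - (A *v \<mu>) $ i - A $ i $ j * y) *s axis i 1 + y *s axis j 1"
  "simple_refl A j (\<mu> + x *s axis i 1 + y *s axis j 1) =
    \<mu> + x *s axis i 1 + (- y - (A *v \<mu>) $ j - A $ j $ i * x) *s axis j 1"
  by (simp_all add: simple_refl_def matrix_vector_right_distrib mult_scale coroot_simple
      diag vec_eq_iff algebra_simps)

lemma int_neg_mult_cases:
  fixes a b :: int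
  assumes "a \<le> 0" "b \<le> 0"
  shows "a * b = 1 \<Longrightarrow> a = -1 \<and> b = -1"
    and "a * b = 2 \<Longrightarrow> a = -1 \<and> b = -2 \<or> a = -2 \<and> b = -1"
    and "a * b = 3 \<Longrightarrow> a = -1 \<and> b = -3 \<or> a = -3 \<and> b = -1"
proof -
  have *: "a \<in> {-3..0} \<and> b \<in> {-3..0}" if "0 < a * b" "a * b \<le> 3"
  proof -
    have "a < 0" "b < 0" using that(1) assms by (auto simp: zero_less_mult_iff)
    then have "- a \<le> a * b" "- b \<le> a * b"
      using mult_left_mono_neg[of b "-1" a] mult_right_mono_neg[of a "-1" b] by auto
    with that(2) show ?thesis using assms by auto
  qed
  have "{-3..0} = {-3, -2, -1, 0::int}" by auto
  then show "a * b = 1 \<Longrightarrow> a = -1 \<and> b = -1"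
    "a * b = 2 \<Longrightarrow> a = -1 \<and> b = -2 \<or> a = -2 \<and> b = -1"
    "a * b = 3 \<Longrightarrow> a = -1 \<and> b = -3 \<or> a = -3 \<and> b = -1"
    using * by auto
qed

text \<open>The exponent 0 arises from equal letters and from a product of at least 4; otherwise the
  two entries are determined up to exchange.\<close>

lemma cox_exp_cases:
  obtains (inf) "i = j" "cox_exp A i j = 0"
  | (inf') "i \<noteq> j" "cox_exp A i j = 0" "A $ i $ j * A $ j $ i \<ge> 4"
  | (m2) "i \<noteq> j" "cox_exp A i j = 2" "A $ i $ j = 0" "A $ j $ i = 0"
  | (m3) "i \<noteq> j" "cox_exp A i j = 3" "A $ i $ j = -1" "A $ j $ i = -1"
  | (m4) "i \<noteq> j" "cox_exp A i j = 4" "A $ i $ j = -1" "A $ j $ i = -2"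
  | (m4') "i \<noteq> j" "cox_exp A i j = 4" "A $ i $ j = -2" "A $ j $ i = -1"
  | (m6) "i \<noteq> j" "cox_exp A i j = 6" "A $ i $ j = -1" "A $ j $ i = -3"
  | (m6') "i \<noteq> j" "cox_exp A i j = 6" "A $ i $ j = -3" "A $ j $ i = -1"
proof (cases "i = j")
  case True
  then show ?thesis using inf by (simp add: cox_exp_def diag)
next
  case False
  let ?p = "A $ i $ j * A $ j $ i"
  have n: "A $ i $ j \<le> 0" "A $ j $ i \<le> 0" using off_diag False by auto
  then have "0 \<le> ?p" by (simp add: mult_nonpos_nonpos)
  then consider "?p = 0" | "?p = 1" | "?p = 2" | "?p = 3" | "?p \<ge> 4" by linarith
  then show ?thesis
  proof cases
    case 1
    then have "A $ i $ j = 0 \<and> A $ j $ i = 0" using sym_zero by auto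
    then show ?thesis using m2 False by (simp add: cox_exp_def)
  next
    case 2
    then show ?thesis using m3 False int_neg_mult_cases(1)[OF n 2] by (auto simp: cox_exp_def)
  next
    case 3
    then show ?thesis using m4 m4' False int_neg_mult_cases(2)[OF n 3] by (auto simp: cox_exp_def)
  next
    case 4
    then show ?thesis using m6 m6' False int_neg_mult_cases(3)[OF n 4] by (auto simp: cox_exp_def)
  next
    case 5
    then have "cox_exp A i j = 0" by (auto simp: cox_exp_def Let_def)
    then show ?thesis using inf' False 5 by simp
  qed
qed

lemma R_relator:
  assumes "r \<in> relators A" shows "R r \<mu> = \<mu>"
proof -
  have "R (concat (replicate (cox_exp A i j) [i, j])) \<mu> = \<mu>" for i j
  proof -
    define S where "S x y = \<mu> + x *s axis i 1 + y *s axis j 1" for x y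
    have "simple_refl A i (S x y) = S (- x - (A *v \<mu>) $ i - A $ i $ j * y) y"
      "simple_refl A j (S x y) = S x (- y - (A *v \<mu>) $ j - A $ j $ i * x)" for x y
      unfolding S_def by (rule refl_dihedral)+
    then have "R (concat (replicate (cox_exp A i j) [i, j])) (S 0 0) = S 0 0"
      by (cases i j rule: cox_exp_cases) (simp_all add: eval_nat_numeral)
    then show ?thesis by (simp add: S_def)
  qed
  with assms show ?thesis by (auto simp: relators_def refl_refl)
qed

lemma R_cong: "cl x = cl y \<Longrightarrow> R x = R y"
  by (rule word_invariant[of R]) (auto simp: R_relator fun_eq_iff)

lemma R_rev: "R (rev x) (R x \<mu>) = \<mu>" "R x (R (rev x) \<mu>) = \<mu>"
  using R_cong[OF cl_rev_append(1), of x] R_cong[OF cl_rev_append(2), of x]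
  by (auto simp: fun_eq_iff)

lemma R_eq_iff: "R x \<mu> = R x \<nu> \<longleftrightarrow> \<mu> = \<nu>"
  using R_rev by metis

lemma act_cl: "act A (cl x) \<mu> = R x \<mu>"
proof -
  have "R y \<mu> = R x \<mu>" if "y \<in> cl x" for y
    using that R_cong[of y x] by (simp add: mem_cl_iff)
  moreover have "x \<in> cl x" by (simp add: mem_cl_iff)
  ultimately have "(\<lambda>x. R x \<mu>) ` cl x = {R x \<mu>}" by blast
  then show ?thesis by (simp add: act_def)
qed

end

section \<open>Positivity of roots and length\<close>

definition nonneg_vec :: "int^'n::finite \<Rightarrow> bool" where
  "nonneg_vec \<mu> \<longleftrightarrow> (\<forall>k. 0 \<le> \<mu> $ k)"

lemma nonneg_vec_comb:
  "nonneg_vec \<mu> \<Longrightarrow> nonneg_vec \<nu> \<Longrightarrow> 0 \<le> a \<Longrightarrow> 0 \<le> b \<Longrightarrow> nonneg_vec (a *s \<mu> + b *s \<nu>)"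
  by (simp add: nonneg_vec_def)

lemma nonneg_vec_antisym: "nonneg_vec \<mu> \<Longrightarrow> nonneg_vec (- \<mu>) \<Longrightarrow> \<mu> = 0"
  by (simp add: nonneg_vec_def vec_eq_iff order_antisym)

lemma nonneg_vec_axis: "nonneg_vec (axis i 1)"
  by (simp add: nonneg_vec_def axis_def)

lemma (in weyl_words) cl_rev_cong: "cl x = cl y \<Longrightarrow> cl (rev x) = cl (rev y)"
  using cl_rev_append(1)[of x] cl_rev_append(1)[of y] cl_append_cong[of "rev y" "rev y" x y]
    cl_cancel_right[of "rev x" x "rev y"] by simp

lemma (in weyl_words) L_rev: "L (rev x) = L x"
proof -
  have "L (rev x) \<le> L x" for x
  proof -
    obtain y where y: "cl y = cl x" "length y = L x" using ex_reduced by blast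
    then show ?thesis using L_le[OF cl_rev_cong[OF y(1)]] by simp
  qed
  from this[of x] this[of "rev x"] show ?thesis by simp
qed

text \<open>With \<open>m\<close> the exponent, the first \<open>m + 1\<close> letters already
  collapse: a braid relation after the first letter creates a repeated \<open>s\<close>, whose
  cancellation leaves \<open>m - 1\<close> letters.\<close>

lemma (in weyl_words) L_alt_le:
  assumes "cox_exp A s t > 0" "cox_exp A s t < k"
  shows "L (alt s t k) < k"
proof -
  let ?m = "cox_exp A s t"
  obtain l where k: "k = Suc ?m + l" using assms(2) by (metis Suc_leI le_Suc_ex)
  obtain n where n: "?m = Suc n" using assms(1) by (cases ?m) auto
  have "cl (alt s t (Suc ?m)) = cl ([s] @ alt s t ?m)"
    using cl_append_cong[OF refl cl_braid[OF assms(1)], of "[s]"] by simp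
  also have "\<dots> = cl (alt t s n)" using cl_double[of "[]" s "alt t s n"] n by simp
  finally have "L (alt s t (Suc ?m)) \<le> n" using L_le[of "alt t s n"] by simp
  moreover obtain z where z: "alt s t (Suc ?m + l) = alt s t (Suc ?m) @ z" "length z = l"
    using alt_prefix[of s t "Suc ?m" l] by (elim exE conjE)
  moreover have "L (alt s t k) \<le> L (alt s t (Suc ?m)) + L z"
    unfolding k z(1) by (rule L_append)
  ultimately show ?thesis using L_le_length[of z] unfolding k n by linarith
qed

section \<open>Roots in rank two, and the sign of a root\<close>

context gcm_words
begin

lemma refl_dihedral_pair:
  "simple_refl A i (x *s axis i 1 + y *s axis j 1) = (- x - A $ i $ j * y) *s axis i 1 + y *s axis j 1"
  "simple_refl A j (x *s axis i 1 + y *s axis j 1) = x *s axis i 1 + (- y - A $ j $ i * x) *s axis j 1"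
  using refl_dihedral[where i = i and j = j and \<mu> = 0 and x = x and y = y]
  by simp_all

lemma R_alt_Suc:
  "R (rev (alt j i (Suc k))) \<mu> = simple_refl A (if even k then j else i) (R (rev (alt j i k)) \<mu>)"
  by (simp add: alt_snoc del: alt.simps)

text \<open>The final inequality carries the induction: it makes the coefficient that is reflected
  next not decrease, hence stay nonnegative.\<close>

lemma R_alt_infinite:
  assumes "A $ i $ j \<le> 0" "A $ j $ i \<le> 0" "A $ i $ j * A $ j $ i \<ge> 4"
  shows "\<exists>x y. 0 \<le> x \<and> 0 \<le> y \<and> R (rev (alt j i k)) (axis i 1) = x *s axis i 1 + y *s axis j 1 \<and>
    (if even k then 2 * y \<le> - A $ j $ i * x else 2 * x \<le> - A $ i $ j * y)"
proof (induction k)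
  case 0
  show ?case by (intro exI[of _ 1] exI[of _ 0]) (use assms in simp)
next
  case (Suc k)
  \<comment> \<open>The inequality returns with the roles exchanged because
    \<open>2 * a * (b * x - y)\<close> is at least \<open>a * b * x\<close>, hence at least
    \<open>4 * x\<close>.\<close>
  have step: "0 \<le> b * x - y \<and> 2 * x \<le> a * (b * x - y)"
    if "0 \<le> x" "0 \<le> y" "2 * y \<le> b * x" "0 \<le> a" "4 \<le> a * b" for a b x y :: int
  proof -
    have "a * (2 * y) \<le> a * (b * x)" "4 * x \<le> (a * b) * x"
      using that by (auto intro: mult_left_mono mult_right_mono)
    then show ?thesis using that by (simp add: algebra_simps)
  qed
  obtain x y where xy: "0 \<le> x" "0 \<le> y"
    "R (rev (alt j i k)) (axis i 1) = x *s axis i 1 + y *s axis j 1"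
    "if even k then 2 * y \<le> - A $ j $ i * x else 2 * x \<le> - A $ i $ j * y"
    using Suc by blast
  show ?case
  proof (cases "even k")
    case True
    then have "R (rev (alt j i (Suc k))) (axis i 1) = x *s axis i 1 + (- y - A $ j $ i * x) *s axis j 1"
      by (simp only: R_alt_Suc xy(3) if_True refl_dihedral_pair)
    moreover have "0 \<le> - A $ j $ i * x - y \<and> 2 * x \<le> - A $ i $ j * (- A $ j $ i * x - y)"
      using step[of x y "- A $ j $ i" "- A $ i $ j"] xy True assms by simp
    ultimately show ?thesis
      using xy True by (intro exI[of _ x] exI[of _ "- y - A $ j $ i * x"]) (simp add: algebra_simps)
  next
    case False
    then have "R (rev (alt j i (Suc k))) (axis i 1) = (- x - A $ i $ j * y) *s axis i 1 + y *s axis j 1"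
      by (simp only: R_alt_Suc xy(3) if_False refl_dihedral_pair)
    moreover have "0 \<le> - A $ i $ j * y - x \<and> 2 * y \<le> - A $ j $ i * (- A $ i $ j * y - x)"
      using step[of y x "- A $ i $ j" "- A $ j $ i"] xy False assms by (simp add: mult.commute)
    ultimately show ?thesis
      using xy False by (intro exI[of _ "- x - A $ i $ j * y"] exI[of _ y]) (simp add: algebra_simps)
  qed
qed

text \<open>For a positive exponent only finitely many roots occur and each is computed outright;
  for exponent 0 the previous lemma applies.\<close>

lemma R_alt_nonneg:
  assumes "i \<noteq> j" "cox_exp A i j = 0 \<or> k < cox_exp A i j"
  shows "\<exists>x y. 0 \<le> x \<and> 0 \<le> y \<and> R (rev (alt j i k)) (axis i 1) = x *s axis i 1 + y *s axis j 1"
proof -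
  define S where "S x y = x *s axis i 1 + y *s axis j 1" for x y :: int
  define P where "P \<mu> \<longleftrightarrow> (\<exists>x y. 0 \<le> x \<and> 0 \<le> y \<and> \<mu> = S x y)" for \<mu>
  have [simp]: "P (S x y)" if "0 \<le> x" "0 \<le> y" for x y using that unfolding P_def by blast
  have S: "simple_refl A i (S x y) = S (- x - A $ i $ j * y) y"
    "simple_refl A j (S x y) = S x (- y - A $ j $ i * x)" for x y
    unfolding S_def by (rule refl_dihedral_pair)+
  have "P (R (rev (alt j i k)) (S 1 0))"
  proof (cases i j rule: cox_exp_cases)
    case inf'
    then show ?thesis
      using R_alt_infinite[of i j k] off_diag assms(1) by (auto simp: P_def S_def)
  qed (use assms in \<open>auto simp: eval_nat_numeral less_Suc_eq S\<close>)
  then show ?thesis by (simp add: P_def S_def)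
qed

text \<open>With \<open>t\<close> the last letter of a reduced word of \<open>x\<close>, the proof splits \<open>x = v d\<close> with \<open>d\<close> a longest
  possible suffix in the letters \<open>s\<close>, \<open>t\<close>. Then both \<open>s\<close> and \<open>t\<close> lengthen \<open>v\<close>, and \<open>d s\<close> is reduced, so
  that \<open>d \<alpha>\<^sub>s\<close> is a nonnegative combination of \<open>\<alpha>\<^sub>s\<close> and \<open>\<alpha>\<^sub>t\<close>.\<close>

theorem nonneg_if_L_less:
  "L x < L (x @ [s]) \<Longrightarrow> nonneg_vec (R x (axis s 1))"
proof (induction "L x" arbitrary: x s rule: less_induct)
  case less
  show ?case
  proof (cases "L x = 0")
    case True
    then have "R x = R []" by (intro R_cong L_eq_0)
    then show ?thesis by (simp add: nonneg_vec_axis)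
  next
    case False
    obtain x0 where x0: "cl x0 = cl x" "length x0 = L x" using ex_reduced by blast
    then obtain y t where yt: "x0 = y @ [t]" using False by (cases x0 rule: rev_cases) auto
    have "t \<noteq> s"
    proof
      assume "t = s"
      then have "cl (x @ [s]) = cl y" using x0 yt by (simp add: cl_append_single)
      then show False using L_le_length[of y] x0(2) yt less.prems by simp
    qed
    define P where "P n \<longleftrightarrow>
      (\<exists>v d. cl (v @ d) = cl x \<and> set d \<subseteq> {s, t} \<and> length d = n \<and> L v + n = L x)" for n
    have "L x \<le> L y + 1" using L_append[of y "[t]"] L_le_length[of "[t]"] x0 yt by simp
    moreover have "cl (y @ [t]) = cl x" "L x = Suc (length y)" using x0 yt by auto
    ultimately have "P 1" unfolding P_def using L_le_length[of y]
      by (intro exI[of _ y] exI[of _ "[t]"]) simp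
    have "\<forall>n. P n \<longrightarrow> id n < Suc (L x)" by (auto simp: P_def)
    with \<open>P 1\<close> have "\<exists>n. P n \<and> (\<forall>k. P k \<longrightarrow> id k \<le> id n)" by (rule ex_has_greatest_nat)
    then obtain n where n: "P n" "\<And>k. P k \<Longrightarrow> k \<le> n" by auto
    obtain v d where vd: "cl (v @ d) = cl x" "set d \<subseteq> {s, t}" "length d = n" "L v + n = L x"
      using n(1) unfolding P_def by blast
    \<comment> \<open>As \<open>d\<close> is nonempty, \<open>v\<close> is shorter than
      \<open>x\<close>, so the induction hypothesis applies to \<open>v\<close>.\<close>
    have "1 \<le> n" using n(2) \<open>P 1\<close> .
    \<comment> \<open>A letter shortening \<open>v\<close> could be moved to the front of
      \<open>d\<close>, against the maximality of \<open>n\<close>.\<close>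
    have up: "L v < L (v @ [r])" if "r \<in> {s, t}" for r
    proof (rule ccontr)
      assume "\<not> L v < L (v @ [r])"
      then have "L v = Suc (L (v @ [r]))" by (cases rule: L_snoc_cases[where x = v and i = r]) auto
      then have "P (Suc n)" unfolding P_def using vd that cl_double[of v r d]
        by (intro exI[of _ "v @ [r]"] exI[of _ "r # d"]) auto
      with n(2) show False by fastforce
    qed
    have pos: "nonneg_vec (R v (axis s 1))" "nonneg_vec (R v (axis t 1))"
      using less.hyps[of v] up vd(4) \<open>1 \<le> n\<close> by auto
    let ?e = "d @ [s]"
    have "Suc (L x) \<le> L (x @ [s])" using less.prems by simp
    also have "L (x @ [s]) = L (v @ ?e)" using cl_append_cong[OF vd(1) refl, of "[s]"] by simp
    also have "\<dots> \<le> L v + L ?e" by (rule L_append)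
    finally have e: "length ?e \<le> L ?e" using vd by simp
    have "?e \<noteq> p @ [i, i] @ q" for p i q
    proof
      assume *: "?e = p @ [i, i] @ q"
      then have "L ?e \<le> length (p @ q)" using L_le_length[of "p @ q"] cl_double[of p i q] by simp
      then show False using e arg_cong[OF *, of length] by simp
    qed
    then obtain k where k: "?e = rev (alt s t k)"
      using alternating_eq_alt[of ?e s t] vd(2) by auto
    have len: "length ?e = k" by (simp add: k)
    then have "k = Suc n" using vd by simp
    have "L (alt s t k) = L ?e" using k L_rev by metis
    then have "cox_exp A s t = 0 \<or> n < cox_exp A s t"
      using L_alt_le[of s t k] e len \<open>k = Suc n\<close> by force
    moreover have "d = rev (alt t s n)" using k \<open>k = Suc n\<close> by simp
    ultimately obtain a b where ab: "0 \<le> a" "0 \<le> b"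
      "R d (axis s 1) = a *s axis s 1 + b *s axis t 1"
      using R_alt_nonneg[of s t n] \<open>t \<noteq> s\<close> by auto
    have "R x (axis s 1) = R (v @ d) (axis s 1)" using R_cong[OF vd(1)] by simp
    also have "\<dots> = a *s R v (axis s 1) + b *s R v (axis t 1)"
      by (simp add: ab R_add R_scale)
    finally show ?thesis using nonneg_vec_comb pos ab by simp
  qed
qed

lemma R_snoc_simple: "R (x @ [s]) (axis s 1) = - R x (axis s 1)"
  by (simp add: simple_refl_self R_minus)

lemma nonpos_if_L_less: "L (x @ [s]) < L x \<Longrightarrow> nonneg_vec (- R x (axis s 1))"
  using nonneg_if_L_less[of "x @ [s]" s, unfolded R_snoc_simple] cl_double[of x s "[]"] by simp

lemma R_simple_nonzero: "R x (axis s 1) \<noteq> 0"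
  using R_eq_iff[where \<mu> = "axis s 1" and \<nu> = 0 and x = x] by (simp add: R_zero)

text \<open>Lengthening and shortening exclude each other, and so do the two signs of a nonzero
  vector; hence the one-sided implications have converses.\<close>

lemma L_less_iff: "L x < L (x @ [s]) \<longleftrightarrow> nonneg_vec (R x (axis s 1))"
  using nonneg_if_L_less[where x = x and s = s] nonpos_if_L_less[where x = x and s = s]
    nonneg_vec_antisym R_simple_nonzero[where x = x and s = s]
  by (cases rule: L_snoc_cases[where x = x and i = s]) auto

lemma root_sign: "nonneg_vec (R x (axis s 1)) \<or> nonneg_vec (- R x (axis s 1))"
  using nonneg_if_L_less[where x = x and s = s] nonpos_if_L_less[where x = x and s = s]
  by (cases rule: L_snoc_cases[where x = x and i = s]) auto

text \<open>Otherwise the last letter of a reduced word would shorten \<open>x\<close> and so make a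
  simple root negative. Uniqueness of root reflections and injectivity of alcoves both rest on this
  test.\<close>

lemma cl_eq_Nil:
  assumes "\<And>s. nonneg_vec (R x (axis s 1))"
  shows "cl x = cl []"
proof (rule ccontr)
  assume "cl x \<noteq> cl []"
  obtain y where y: "cl y = cl x" "length y = L x" using ex_reduced by blast
  with \<open>cl x \<noteq> cl []\<close> obtain z t where "y = z @ [t]" by (cases y rule: rev_cases) auto
  then have "L (x @ [t]) < L x" using y L_le_length[of z] cl_append_single[of x t z] by simp
  then show False using L_less_iff[of x t] assms[of t] by simp
qed

text \<open>The quotient \<open>t\<close> of two reflections in the same root \<open>\<alpha>\<^sub>j\<close> fixes \<open>\<alpha>\<^sub>j\<close> and changes every root only
  by a multiple of \<open>\<alpha>\<^sub>j\<close>, so it keeps all simple roots positive.\<close>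

lemma root_reflection_unique:
  assumes "R u (axis i 1) = R v (axis j 1)"
  shows "cl (u @ [i] @ rev u) = cl (v @ [j] @ rev v)"
proof -
  \<comment> \<open>Conjugating by the inverse of \<open>v\<close> reduces to the case where the
    common root is the simple root of \<open>j\<close>.\<close>
  define x where "x = rev v @ u"
  have x: "R x (axis i 1) = axis j 1" by (simp add: x_def assms R_rev)
  define t where "t = (x @ [i] @ rev x) @ [j]"
  have act_refl: "R (x @ [i] @ rev x) \<mu> = \<mu> - (A *v R (rev x) \<mu>) $ i *s axis j 1" for \<mu>
    by (simp add: simple_refl_def R_diff R_scale R_rev x)
  have "nonneg_vec (R t (axis k 1))" for k
  proof (cases "k = j")
    case True
    have "R t (axis j 1) = - R (x @ [i] @ rev x) (axis j 1)"
      unfolding t_def by (rule R_snoc_simple)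
    also have "\<dots> = axis j 1"
      by (simp add: x[symmetric] R_rev simple_refl_self R_minus)
    finally show ?thesis using True by (simp add: nonneg_vec_axis)
  next
    case False
    have "R t (axis k 1) = R (x @ [i] @ rev x) (simple_refl A j (axis k 1))" by (simp add: t_def)
    \<comment> \<open>Only the coefficient at \<open>j\<close> changes, and one positive coefficient
      decides the sign of a root.\<close>
    also have "\<dots> $ k = 1" unfolding act_refl simple_refl_simple using False by (simp add: axis_def)
    finally have "\<not> nonneg_vec (- R t (axis k 1))"
      unfolding nonneg_vec_def not_all by (intro exI[of _ k]) simp
    then show ?thesis using root_sign[where x = t and s = k] by blast
  qed
  then have "cl t = cl []" by (rule cl_eq_Nil)
  then have "cl (x @ [i] @ rev x) = cl [j]"
    unfolding t_def by (simp only: cl_append_single append_Nil)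
  then have "cl (v @ (x @ [i] @ rev x) @ rev v) = cl (v @ [j] @ rev v)"
    by (rule cl_append_cong[OF refl cl_append_cong[OF _ refl]])
  moreover have vx: "cl (v @ x) = cl u"
    using cl_append_cong[OF cl_rev_append(2) refl, of v u] by (simp add: x_def)
  have "cl ((v @ x) @ [i] @ rev (v @ x)) = cl (u @ [i] @ rev u)"
    by (intro cl_append_cong[OF vx cl_append_cong[OF refl cl_rev_cong[OF vx]]])
  ultimately show ?thesis by simp
qed

end

section \<open>The Yang--Baxter relations\<close>

definition yb_step ::
  "(('w \<Rightarrow> 'r::comm_ring_1) \<Rightarrow> 'w \<Rightarrow> 'r) \<Rightarrow> 'r \<Rightarrow> ('w \<Rightarrow> 'r) \<Rightarrow> 'w \<Rightarrow> 'r" where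
  "yb_step p c f = (\<lambda>x. f x + c * p f x)"

text \<open>The braid relation is assumed separately in each identity, for one function
  \<open>f\<close>: for the operators below it is available on functions that respect word
  equality.\<close>

locale nil_pair =
  fixes p q :: "('w \<Rightarrow> 'r::comm_ring_1) \<Rightarrow> 'w \<Rightarrow> 'r"
  assumes p_add: "p (\<lambda>x. f x + g x) = (\<lambda>x. p f x + p g x)"
    and q_add: "q (\<lambda>x. f x + g x) = (\<lambda>x. q f x + q g x)"
    and p_scale: "p (\<lambda>x. c * f x) = (\<lambda>x. c * p f x)"
    and q_scale: "q (\<lambda>x. c * f x) = (\<lambda>x. c * q f x)"
    and p_nil: "p (p f) = (\<lambda>x. 0)"
    and q_nil: "q (q f) = (\<lambda>x. 0)"
begin

lemma p_zero: "p (\<lambda>x. 0) = (\<lambda>x. 0)" and q_zero: "q (\<lambda>x. 0) = (\<lambda>x. 0)"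
  using p_scale[of 0 "\<lambda>x. 0"] q_scale[of 0 "\<lambda>x. 0"] by simp_all

lemmas expand = yb_step_def p_add q_add p_scale q_scale p_nil q_nil p_zero q_zero

text \<open>The coefficients are the positive roots of the rank two root systems, listed in the order in
  which an alternating word meets them.\<close>

lemma yang_baxter_2:
  assumes "p (q f) = q (p f)"
  shows "yb_step q b (yb_step p a f) = yb_step p a (yb_step q b f)"
  by (simp add: expand assms, simp add: algebra_simps)

lemma yang_baxter_3:
  assumes "p (q (p f)) = q (p (q f))"
  shows "yb_step p b (yb_step q (a + b) (yb_step p a f)) =
    yb_step q a (yb_step p (a + b) (yb_step q b f))"
  by (simp add: expand assms, simp add: algebra_simps)

lemma yang_baxter_4:
  assumes "p (q (p (q f))) = q (p (q (p f)))"
  shows "yb_step q b (yb_step p (a + 2 * b) (yb_step q (a + b) (yb_step p a f))) =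
    yb_step p a (yb_step q (a + b) (yb_step p (a + 2 * b) (yb_step q b f)))"
  by (simp add: expand assms, simp add: algebra_simps)

lemma yang_baxter_6:
  assumes "p (q (p (q (p (q f))))) = q (p (q (p (q (p f)))))"
  shows "yb_step q b (yb_step p (a + 3 * b) (yb_step q (a + 2 * b) (yb_step p (2 * a + 3 * b)
      (yb_step q (a + b) (yb_step p a f))))) =
    yb_step p a (yb_step q (a + b) (yb_step p (2 * a + 3 * b) (yb_step q (a + 2 * b)
      (yb_step p (a + 3 * b) (yb_step q b f)))))"
  by (simp add: expand assms, simp add: algebra_simps)

end

section \<open>Mask sums\<close>

lemma root_pol_add: "root_pol (\<mu> + \<nu>) = root_pol \<mu> + root_pol \<nu>"
  by (simp add: root_pol_def single_add sum.distrib)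

lemma root_pol_scale:
  fixes \<mu> :: "int^'n::finite"
  shows "root_pol (c *s \<mu>) = of_int c * root_pol \<mu>"
proof -
  have c: "Poly_Mapping.single 0 c = (of_int c :: 'n mpol)"
    by (metis of_int_eq_id id_apply single_of_int)
  have "Poly_Mapping.single m (c * a) = of_int c * Poly_Mapping.single m a" for m :: "'n \<Rightarrow>\<^sub>0 nat" and a
    using mult_single[of 0 c m a] by (simp add: c)
  then show ?thesis by (simp add: root_pol_def sum_distrib_left)
qed

context gcm_words
begin

definition drop_op :: "'n \<Rightarrow> ('n list \<Rightarrow> 'r::comm_ring_1) \<Rightarrow> 'n list \<Rightarrow> 'r" where
  "drop_op i f x = (if L (x @ [i]) < L x then f (x @ [i]) else 0)"

text \<open>A letter lowers the length by at most one, so a total drop of \<open>length w\<close>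
  forces a drop at every letter.\<close>

lemma drop_op_word:
  "foldr drop_op w f x = (if L (x @ w) + length w = L x then f (x @ w) else 0)"
proof (induction w arbitrary: x)
  case (Cons i w)
  have "L (x @ [i]) \<le> L ((x @ [i]) @ w) + length w"
    using L_append[of "(x @ [i]) @ w" "rev w"] cl_append_cong[OF refl cl_rev_append(2), of "x @ [i]" w]
      L_le_length[of "rev w"] by simp
  then show ?case
    using Cons.IH[of "x @ [i]"] by (cases rule: L_snoc_cases[where x = x and i = i]) (auto simp: drop_op_def)
qed simp

text \<open>This contains the nil-Coxeter braid relations. As \<open>x @ w\<close> and
  \<open>x @ w'\<close> are different words, \<open>f\<close> has to respect word equality.\<close>

lemma drop_op_word_cong:
  assumes "cl w = cl w'" "length w = length w'" "\<And>x y. cl x = cl y \<Longrightarrow> f x = f y"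
  shows "foldr drop_op w f = foldr drop_op w' f"
proof
  fix x
  have "cl (x @ w) = cl (x @ w')" using cl_append_cong[OF refl assms(1)] .
  then show "foldr drop_op w f x = foldr drop_op w' f x"
    using assms(2) assms(3)[of "x @ w" "x @ w'"] by (simp add: drop_op_word)
qed

lemma drop_op_nil: "drop_op i (drop_op i f) = (\<lambda>x. 0)"
proof
  fix x
  show "drop_op i (drop_op i f) x = 0"
    using cl_double[of x i "[]"] by (simp add: drop_op_def)
qed

lemma nil_pair_drop_op: "nil_pair (drop_op i) (drop_op j)"
  by unfold_locales (auto simp: drop_op_nil, auto simp: drop_op_def fun_eq_iff)

definition masked :: "'n list \<Rightarrow> bool list \<Rightarrow> 'n list" where
  "masked ks \<epsilon> = map fst (filter snd (zip ks \<epsilon>))"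

definition label_pol :: "'n list \<Rightarrow> 'n \<Rightarrow> 'n mpol" where
  "label_pol ks i = root_pol (R ks (axis i 1))"

definition masks :: "'n list \<Rightarrow> 'n list \<Rightarrow> bool list set" where
  "masks ks x = {\<epsilon>. length \<epsilon> = length ks \<and> length (masked ks \<epsilon>) = L x \<and> cl (masked ks \<epsilon>) = cl x}"

definition weight :: "'n list \<Rightarrow> bool list \<Rightarrow> 'n mpol" where
  "weight ks \<epsilon> = (\<Prod>j\<in>{j. j < length ks \<and> \<epsilon> ! j}. label_pol (take j ks) (ks ! j))"

definition mask_sum :: "'n list \<Rightarrow> 'n list \<Rightarrow> 'n mpol" where
  "mask_sum ks x = (\<Sum>\<epsilon>\<in>masks ks x. weight ks \<epsilon>)"

lemma finite_masks: "finite (masks ks x)"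
  using finite_lists_length_eq[of "UNIV :: bool set" "length ks"]
  by (rule rev_finite_subset) (auto simp: masks_def)

lemma masked_snoc:
  "length \<epsilon> = length ks \<Longrightarrow> masked (ks @ [i]) (\<epsilon> @ [e]) = masked ks \<epsilon> @ (if e then [i] else [])"
  by (simp add: masked_def)

lemma weight_snoc:
  assumes "length \<epsilon> = length ks"
  shows "weight (ks @ [i]) (\<epsilon> @ [e]) = (if e then label_pol ks i else 1) * weight ks \<epsilon>"
proof -
  let ?J = "{j. j < length ks \<and> \<epsilon> ! j}"
  have "{j. j < length (ks @ [i]) \<and> (\<epsilon> @ [e]) ! j} = ?J \<union> (if e then {length ks} else {})"
    using assms by (auto simp: nth_append less_Suc_eq)
  moreover have "(\<Prod>j\<in>?J. label_pol (take j (ks @ [i])) ((ks @ [i]) ! j)) = weight ks \<epsilon>"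
    unfolding weight_def by (rule prod.cong) (auto simp: nth_append)
  ultimately show ?thesis by (simp add: weight_def)
qed

text \<open>If the last letter is selected, the others spell \<open>x @ [i]\<close> with one letter
  fewer than the length of \<open>x\<close>, which is impossible when \<open>i\<close> lengthens
  \<open>x\<close>. This is the origin of the length condition in \<open>drop_op\<close>.\<close>

lemma masks_snoc:
  "masks (ks @ [i]) x = (\<lambda>\<epsilon>. \<epsilon> @ [False]) ` masks ks x \<union>
    (if L (x @ [i]) < L x then (\<lambda>\<epsilon>. \<epsilon> @ [True]) ` masks ks (x @ [i]) else {})" (is "?l = ?r")
proof -
  have F: "\<epsilon> @ [False] \<in> masks (ks @ [i]) x \<longleftrightarrow> \<epsilon> \<in> masks ks x" for \<epsilon>
    by (simp add: masks_def masked_snoc cong: conj_cong)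
  have T: "\<epsilon> @ [True] \<in> masks (ks @ [i]) x \<longleftrightarrow> L (x @ [i]) < L x \<and> \<epsilon> \<in> masks ks (x @ [i])" for \<epsilon>
  proof -
    have le: "L (x @ [i]) \<le> length (masked ks \<epsilon>)" if "cl (masked ks \<epsilon>) = cl (x @ [i])"
      using L_le[OF that] .
    have snoc_iff: "\<epsilon> @ [True] \<in> masks (ks @ [i]) x \<longleftrightarrow> length \<epsilon> = length ks \<and>
        Suc (length (masked ks \<epsilon>)) = L x \<and> cl (masked ks \<epsilon>) = cl (x @ [i])"
      by (simp add: masks_def masked_snoc cl_append_single cong: conj_cong)
    show ?thesis
    proof (cases rule: L_snoc_cases[where x = x and i = i])
      case 1
      then show ?thesis using le unfolding snoc_iff by linarith
    next
      case 2
      then show ?thesis unfolding snoc_iff by (simp add: masks_def)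
    qed
  qed
  have "\<epsilon> \<in> ?l \<longleftrightarrow> \<epsilon> \<in> ?r" for \<epsilon>
  proof (cases \<epsilon> rule: rev_cases)
    case Nil
    then show ?thesis by (auto simp: masks_def)
  next
    case (snoc \<eta> e)
    then show ?thesis using F[of \<eta>] T[of \<eta>] by (cases e) auto
  qed
  then show ?thesis by blast
qed

text \<open>Iterated, this turns the sum over masks into a product of operators, with the last
  letter of the word applied last.\<close>

lemma mask_sum_snoc: "mask_sum (ks @ [i]) = yb_step (drop_op i) (label_pol ks i) (mask_sum ks)"
proof
  fix x
  have w: "(\<Sum>\<epsilon>\<in>(\<lambda>\<epsilon>. \<epsilon> @ [e]) ` masks ks y. weight (ks @ [i]) \<epsilon>) =
      (if e then label_pol ks i else 1) * mask_sum ks y" for e y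
    by (subst sum.reindex)
      (auto simp: inj_on_def mask_sum_def sum_distrib_left masks_def weight_snoc intro!: sum.cong)
  have "mask_sum (ks @ [i]) x = mask_sum ks x +
      (if L (x @ [i]) < L x then label_pol ks i * mask_sum ks (x @ [i]) else 0)"
    unfolding mask_sum_def[of "ks @ [i]"] masks_snoc
    by (subst sum.union_disjoint) (auto simp: finite_masks w)
  then show "mask_sum (ks @ [i]) x = yb_step (drop_op i) (label_pol ks i) (mask_sum ks) x"
    by (simp add: yb_step_def drop_op_def)
qed

lemma mask_sum_cong: "cl x = cl y \<Longrightarrow> mask_sum ks x = mask_sum ks y"
  by (simp add: mask_sum_def masks_def)

text \<open>The labels along \<open>q\<close> see the prefix only through its action.\<close>

lemma mask_sum_append_cong:
  assumes "mask_sum p = mask_sum p'" "R p = R p'"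
  shows "mask_sum (p @ q) = mask_sum (p' @ q)"
proof (induction q rule: rev_induct)
  case Nil
  then show ?case using assms by simp
next
  case (snoc i q)
  have "label_pol (p @ q) i = label_pol (p' @ q) i"
    using assms(2) by (simp add: label_pol_def)
  with snoc show ?case using mask_sum_snoc[of "p @ q" i] mask_sum_snoc[of "p' @ q" i] by simp
qed

section \<open>Invariance of mask sums under the relators\<close>

lemma mask_sum_double: "mask_sum (p @ [i, i]) = mask_sum p"
proof -
  have "label_pol (p @ [i]) i = - label_pol p i"
    using root_pol_scale[of "-1" "R p (axis i 1)"] R_scale[of p "-1"]
    by (simp add: label_pol_def simple_refl_self R_minus) (simp add: root_pol_def single_uminus sum_negf)
  moreover interpret nil_pair "drop_op i" "drop_op i" by (rule nil_pair_drop_op)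
  have "mask_sum ((p @ [i]) @ [i]) = mask_sum p" if "label_pol (p @ [i]) i = - label_pol p i"
    unfolding mask_sum_snoc that by (simp add: expand)
  ultimately show ?thesis by simp
qed

text \<open>Leaving the initial function free lets a concrete alternating word unfold into nested
  \<open>yb_step\<close>s, the shape of the rank two identities.\<close>

fun yb_word :: "'n list \<Rightarrow> 'n list \<Rightarrow> ('n list \<Rightarrow> 'n mpol) \<Rightarrow> 'n list \<Rightarrow> 'n mpol" where
  "yb_word p [] f = f"
| "yb_word p (i # w) f = yb_word (p @ [i]) w (yb_step (drop_op i) (label_pol p i) f)"

lemma mask_sum_append: "mask_sum (p @ w) = yb_word p w (mask_sum p)"
proof (induction w arbitrary: p)
  case (Cons i w)
  then show ?case using Cons[of "p @ [i]"] by (simp add: mask_sum_snoc)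
qed simp

lemma mask_sum_alt:
  assumes "cox_exp A i j > 0"
  shows "mask_sum (p @ alt i j (cox_exp A i j)) = mask_sum (p @ alt j i (cox_exp A i j))"
proof -
  interpret nil_pair "drop_op i :: ('n list \<Rightarrow> 'n mpol) \<Rightarrow> _" "drop_op j" by (rule nil_pair_drop_op)
  interpret swap: nil_pair "drop_op j :: ('n list \<Rightarrow> 'n mpol) \<Rightarrow> _" "drop_op i" by (rule nil_pair_drop_op)
  define S where "S x y = x *s axis i 1 + y *s axis j 1" for x y :: int
  have S: "simple_refl A i (S x y) = S (- x - A $ i $ j * y) y"
    "simple_refl A j (S x y) = S x (- y - A $ j $ i * x)" for x y
    unfolding S_def by (rule refl_dihedral_pair)+
  have ax: "axis i 1 = S 1 0" "axis j 1 = S 0 1" by (simp_all add: S_def)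
  define a b where "a = label_pol p i" and "b = label_pol p j"
  \<comment> \<open>The labels along an alternating word are thus integer combinations of
    \<open>a\<close> and \<open>b\<close>, with the coordinates computed by
    \<open>S\<close>.\<close>
  have pol: "root_pol (R p (S x y)) = of_int x * a + of_int y * b" for x y
    by (simp add: S_def a_def b_def label_pol_def R_add R_scale root_pol_add root_pol_scale)
  have braid: "foldr drop_op (alt i j (cox_exp A i j)) (mask_sum p) =
      foldr drop_op (alt j i (cox_exp A i j)) (mask_sum p)"
    by (rule drop_op_word_cong[OF cl_braid[OF assms]], simp, rule mask_sum_cong)
  note [simp] = eval_nat_numeral label_pol_def ax S pol
  have "yb_word p (alt i j (cox_exp A i j)) (mask_sum p) =
      yb_word p (alt j i (cox_exp A i j)) (mask_sum p)" (is ?eq)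
  proof (cases i j rule: cox_exp_cases)
    case m2
    then show ?eq
      using yang_baxter_2[of "mask_sum p" b a] braid by simp
  next
    case m3
    then show ?eq
      using yang_baxter_3[of "mask_sum p" b a] braid by simp
  next
    case m4
    then show ?eq
      using yang_baxter_4[of "mask_sum p" b a] braid by simp
  next
    \<comment> \<open>The matrix entries are exchanged compared with the previous case, so the
      identity is applied with the two operators swapped.\<close>
    case m4'
    then show ?eq
      using swap.yang_baxter_4[of "mask_sum p" a b] braid by (simp add: add.commute)
  next
    case m6
    then show ?eq
      using yang_baxter_6[of "mask_sum p" b a] braid by simp
  next
    case m6'
    then show ?eq
      using swap.yang_baxter_6[of "mask_sum p" a b] braid by (simp add: add.commute)
  qed (use assms in auto)
  then show ?thesis by (simp only: mask_sum_append)
qed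

lemma mask_sum_rev: "mask_sum (p @ w @ rev w) = mask_sum p"
proof (induction w arbitrary: p)
  case (Cons i w)
  have "mask_sum (p @ (i # w) @ rev (i # w)) = mask_sum (((p @ [i]) @ w @ rev w) @ [i])" by simp
  also have "\<dots> = mask_sum ((p @ [i]) @ [i])"
    by (rule mask_sum_append_cong[OF Cons])
      (use R_cong[OF cl_append_cong[OF refl cl_rev_append(2)], of "p @ [i]" w] in simp)
  finally show ?case using mask_sum_double by simp
qed simp

lemma mask_sum_relator:
  assumes "r \<in> relators A" shows "mask_sum (p @ r @ q) = mask_sum (p @ q)"
proof -
  consider (double) i where "r = [i, i]"
    | (braid) i j where "r = concat (replicate (cox_exp A i j) [i, j])"
    using assms unfolding relators_def by blast
  then have "mask_sum (p @ r) = mask_sum p"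
  proof cases
    case double
    then show ?thesis using mask_sum_double by simp
  next
    case braid
    let ?m = "cox_exp A i j"
    show ?thesis
    proof (cases "?m = 0")
      case False
      let ?x = "alt i j ?m" and ?y = "alt j i ?m"
      have "R (p @ ?x) = R (p @ ?y)"
        by (rule R_cong[OF cl_append_cong[OF refl cl_braid]]) (use False in simp)
      \<comment> \<open>The relator is \<open>?x\<close> followed by the inverse of
        \<open>?y\<close>; replacing \<open>?x\<close> by \<open>?y\<close> leaves a word that
        cancels.\<close>
      then have "mask_sum ((p @ ?x) @ rev ?y) = mask_sum ((p @ ?y) @ rev ?y)"
        using False by (intro mask_sum_append_cong mask_sum_alt) auto
      then show ?thesis using braid mask_sum_rev[of p ?y] by (simp add: concat_replicate_alt)
    qed (use braid in simp)
  qed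
  moreover have "R (p @ r) = R p"
    by (rule R_cong) (use cl_relator[OF assms, of p "[]"] in simp)
  ultimately show ?thesis using mask_sum_append_cong[of "p @ r" p q] by simp
qed

theorem mask_sum_word_cong: "cl ks = cl ks' \<Longrightarrow> mask_sum ks = mask_sum ks'"
  by (rule word_invariant[of mask_sum]) (auto simp: mask_sum_relator)

text \<open>The induction keeps \<open>x\<close> general because \<open>drop_op\<close> evaluates
  the earlier sums at \<open>x @ [k]\<close>.\<close>

theorem mask_sum_reflection:
  "label_pol p i dvd mask_sum (p @ q) x - mask_sum (p @ [i] @ q) x"
proof (induction q arbitrary: x rule: rev_induct)
  case Nil
  show ?case by (simp add: mask_sum_snoc yb_step_def)
next
  case (snoc k q)
  let ?\<beta> = "label_pol p i" and ?c = "label_pol (p @ q) k" and ?c' = "label_pol (p @ [i] @ q) k"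
  have "R p (R q (axis k 1)) = R (p @ [i] @ q) (axis k 1) +
      (A *v R q (axis k 1)) $ i *s R p (axis i 1)"
    by (simp add: simple_refl_def R_diff R_scale)
  then have c: "?c = ?c' + of_int ((A *v R q (axis k 1)) $ i) * ?\<beta>"
    by (simp add: label_pol_def root_pol_add root_pol_scale)
  let ?f = "mask_sum (p @ q)" and ?g = "mask_sum (p @ [i] @ q)"
  have "drop_op k ?f x - drop_op k ?g x = (if L (x @ [k]) < L x then ?f (x @ [k]) - ?g (x @ [k]) else 0)"
    by (simp add: drop_op_def)
  then have d: "?\<beta> dvd drop_op k ?f x - drop_op k ?g x"
    using snoc[of "x @ [k]"] by (simp only: dvd_0_right split: if_split) simp
  \<comment> \<open>This is the product rule for differences: one term compares the functions, the
    other the labels.\<close>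
  have "mask_sum (p @ q @ [k]) x - mask_sum (p @ [i] @ q @ [k]) x =
      (?f x - ?g x) + ?c' * (drop_op k ?f x - drop_op k ?g x) +
      of_int ((A *v R q (axis k 1)) $ i) * ?\<beta> * drop_op k ?f x"
    using mask_sum_snoc[of "p @ q" k] mask_sum_snoc[of "p @ [i] @ q" k] c
    by (simp add: yb_step_def algebra_simps)
  then show ?case using snoc[of x] d by (simp add: dvd_add)
qed

end

section \<open>Alcoves\<close>

text \<open>The first property makes all coefficients of \<open>delta \<theta>\<close> positive, so
  that the base alcove has interior points; the second makes the geometric and the lattice
  reflections correspond.\<close>

locale affine_words = gcm_words A for A :: "int^('i::finite option)^('i option)" +
  fixes \<theta> :: "int^'i"
  assumes theta_pos: "\<And>j. 1 \<le> \<theta> $ j" and null_root: "A *v delta \<theta> = 0"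
begin

text \<open>The sign is chosen so that positive roots are negative inside the base alcove.\<close>

definition aff :: "int^('i option) \<Rightarrow> real^'i \<Rightarrow> real" where
  "aff \<beta> x = pairing x (fin_part \<theta> \<beta>) - real_of_int (level \<beta>)"

definition normal :: "int^('i option) \<Rightarrow> real^'i" where
  "normal \<beta> = (\<chi> j. real_of_int (fin_part \<theta> \<beta> $ j))"

lemma aff_inner: "aff \<beta> x = normal \<beta> \<bullet> x - real_of_int (level \<beta>)"
  by (simp add: aff_def normal_def pairing_def inner_vec_def mult.commute)

lemma sum_option: "(\<Sum>k\<in>UNIV. g k) = g None + (\<Sum>j\<in>UNIV. g (Some j))"
  for g :: "'i option \<Rightarrow> 'b::comm_monoid_add"
  by (simp add: UNIV_option_conv sum.reindex)

lemma aff_diff: "aff (\<mu> - \<nu>) x = aff \<mu> x - aff \<nu> x"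
  by (simp add: aff_def pairing_def fin_part_def level_def algebra_simps sum_subtractf sum.distrib)

lemma aff_scale: "aff (c *s \<mu>) x = real_of_int c * aff \<mu> x"
  by (simp add: aff_def pairing_def fin_part_def level_def algebra_simps sum_distrib_left)

lemma aff_minus: "aff (- \<mu>) x = - aff \<mu> x"
  using aff_diff[of 0 \<mu> x] aff_scale[of 0 0 x] by simp

lemma aff_Some: "aff (axis (Some j) 1) x = x $ j"
proof -
  have "fin_part \<theta> (axis (Some j) 1) = axis j 1"
    by (simp add: fin_part_def level_def axis_def vec_eq_iff)
  then show ?thesis
    by (simp add: aff_def pairing_def level_def) (simp add: axis_def if_distrib cong: if_cong)
qed

lemma aff_None: "aff (axis None 1) x = - (\<Sum>j\<in>UNIV. real_of_int (\<theta> $ j) * x $ j) - 1"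
  by (simp add: aff_def pairing_def level_def fin_part_def axis_def sum_negf mult.commute)

lemma aff_sum: "aff \<beta> x = (\<Sum>k\<in>UNIV. real_of_int (\<beta> $ k) * aff (axis k 1) x)"
  by (simp add: sum_option aff_Some aff_None)
    (simp add: aff_def pairing_def fin_part_def level_def algebra_simps sum_subtractf
      sum_distrib_left sum_distrib_right)

lemma aff_eqI: "(\<And>k. aff (axis k 1) x = aff (axis k 1) y) \<Longrightarrow> x = y"
  by (simp add: vec_eq_iff flip: aff_Some)

lemma aff_neg:
  assumes "nonneg_vec \<beta>" "\<beta> \<noteq> 0" "\<And>k. aff (axis k 1) x < 0" shows "aff \<beta> x < 0"
proof -
  obtain k where "\<beta> $ k \<noteq> 0" using assms(2) by (auto simp: vec_eq_iff)
  then have "0 < \<beta> $ k" using assms(1) by (simp add: nonneg_vec_def order.not_eq_order_implies_strict)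
  then have "real_of_int (\<beta> $ k) * aff (axis k 1) x < 0"
    using assms(3) by (intro mult_pos_neg) auto
  moreover have "(\<Sum>l\<in>UNIV - {k}. real_of_int (\<beta> $ l) * aff (axis l 1) x) \<le> 0"
    using assms by (intro sum_nonpos mult_nonneg_nonpos) (auto simp: nonneg_vec_def less_imp_le)
  ultimately show ?thesis unfolding aff_sum[of \<beta>] by (simp add: sum.remove[of UNIV k])
qed

lemma aff_root_nonzero:
  assumes "\<And>k. aff (axis k 1) x < 0" shows "aff (R u (axis i 1)) x \<noteq> 0"
  using root_sign[where x = u and s = i] R_simple_nonzero[where x = u and s = i]
    aff_neg[of "R u (axis i 1)" x] aff_neg[of "- R u (axis i 1)" x] assms by (auto simp: aff_minus)

text \<open>The null root has the constant value -1, and this is the only constraint on the values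
  at the simple roots.\<close>

lemma ex_point:
  assumes "(\<Sum>k\<in>UNIV. real_of_int (delta \<theta> $ k) * g k) = -1"
  shows "\<exists>x. \<forall>k. aff (axis k 1) x = g k"
proof (intro exI allI)
  fix k
  show "aff (axis k 1) (\<chi> j. g (Some j)) = g k"
    using assms by (cases k) (simp_all add: sum_option aff_Some aff_None delta_def)
qed

lemma delta_pos: "0 < delta \<theta> $ k"
  using theta_pos by (cases k) (auto simp: delta_def less_le_trans[OF zero_less_one])

lemma ex_interior_point: "\<exists>x. \<forall>k. aff (axis k 1) x < 0"
proof -
  let ?s = "\<Sum>k\<in>UNIV. real_of_int (delta \<theta> $ k)"
  have s: "0 < ?s" using delta_pos by (intro sum_pos) auto
  then have "\<exists>x. \<forall>k. aff (axis k 1) x = - 1 / ?s"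
    by (intro ex_point) (simp flip: sum_distrib_right sum_divide_distrib add: sum_negf)
  then obtain x where "\<And>k. aff (axis k 1) x = - 1 / ?s" by blast
  then have "\<forall>k. aff (axis k 1) x < 0" using s by simp
  then show ?thesis by blast
qed

lemma ex_wall_point: "\<exists>x. aff (axis i 1) x = 0 \<and> (\<forall>k. k \<noteq> i \<longrightarrow> aff (axis k 1) x < 0)"
proof -
  let ?s = "\<Sum>k\<in>UNIV - {i}. real_of_int (delta \<theta> $ k)"
  \<comment> \<open>An option type has at least two elements, so some other node remains to carry
    the value -1.\<close>
  have "UNIV - {i} \<noteq> {}"
    by (cases i) auto
  then have s: "0 < ?s" using delta_pos by (intro sum_pos) auto
  then have "\<exists>x. \<forall>k. aff (axis k 1) x = (if k = i then 0 else - 1 / ?s)"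
    by (intro ex_point)
      (simp add: sum.remove[of UNIV i], simp flip: sum_divide_distrib add: sum_negf)
  then obtain x where "\<And>k. aff (axis k 1) x = (if k = i then 0 else - 1 / ?s)" by blast
  then have "aff (axis i 1) x = 0 \<and> (\<forall>k. k \<noteq> i \<longrightarrow> aff (axis k 1) x < 0)" using s by simp
  then show ?thesis by blast
qed

abbreviation GR :: "'i option list \<Rightarrow> real^'i \<Rightarrow> real^'i" where
  "GR k \<equiv> foldr (geom_refl A \<theta>) k"

text \<open>The two reflections are transposes of each other. The null root condition expresses the
  entry at \<open>None\<close> by the others, so the coroot pairs with the finite part of
  \<open>\<beta>\<close> as with \<open>\<beta>\<close> itself.\<close>

lemma aff_geom_refl: "aff \<beta> (geom_refl A \<theta> i x) = aff (simple_refl A i \<beta>) x"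
proof -
  have "A $ i $ None = - (\<Sum>j\<in>UNIV. A $ i $ Some j * \<theta> $ j)"
  proof -
    have "0 = (A *v delta \<theta>) $ i" by (simp add: null_root)
    then show ?thesis by (simp add: matrix_vector_mult_def sum_option delta_def)
  qed
  then have "(\<Sum>j\<in>UNIV. A $ i $ Some j * fin_part \<theta> \<beta> $ j) = (A *v \<beta>) $ i"
    by (simp add: matrix_vector_mult_def sum_option fin_part_def level_def algebra_simps
        sum_subtractf sum_distrib_left)
  then have "normal \<beta> \<bullet> simple_coroot A i = real_of_int ((A *v \<beta>) $ i)"
    by (simp add: normal_def simple_coroot_def inner_vec_def mult.commute flip: of_int_mult of_int_sum)
  moreover have "geom_refl A \<theta> i x = x - aff (axis i 1) x *\<^sub>R simple_coroot A i"
    by (simp add: geom_refl_def aff_def)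
  ultimately show ?thesis
    by (simp add: simple_refl_def aff_diff aff_scale)
      (simp add: aff_inner[of \<beta>] inner_diff_right)
qed

lemma aff_GR: "aff \<beta> (GR k x) = aff (R (rev k) \<beta>) x"
  by (induction k arbitrary: \<beta>) (simp_all add: aff_geom_refl)

lemma GR_cong:
  assumes "cl x = cl y" shows "GR x = GR y"
  by (intro ext aff_eqI) (simp add: aff_GR R_cong[OF cl_rev_cong[OF assms]])

lemma geom_act_cl: "geom_act A \<theta> (cl k) x = GR k x"
proof -
  have "GR y x = GR k x" if "y \<in> cl k" for y
    using that GR_cong[of y k] by (simp add: mem_cl_iff)
  moreover have "k \<in> cl k" by (simp add: mem_cl_iff)
  ultimately have "(\<lambda>k. GR k x) ` cl k = {GR k x}" by blast
  then show ?thesis by (simp add: geom_act_def)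
qed

definition alc :: "'i option list \<Rightarrow> (real^'i) set" where
  "alc u = {x. \<forall>i. aff (R u (axis i 1)) x \<le> 0}"

definition open_alc :: "'i option list \<Rightarrow> (real^'i) set" where
  "open_alc u = {x. \<forall>i. aff (R u (axis i 1)) x < 0}"

lemma GR_rev: "GR u (GR (rev u) x) = x"
  by (rule aff_eqI) (simp add: aff_GR R_rev)

lemma base_alcove_eq: "base_alcove \<theta> = alc []"
  by (simp add: base_alcove_def alc_def aff_def)

lemma alcove_of_cl: "alcove_of A \<theta> (cl u) = alc u"
proof -
  have "GR u x \<in> alc u \<longleftrightarrow> x \<in> base_alcove \<theta>" for x
    by (simp add: base_alcove_eq alc_def aff_GR R_rev)
  then show ?thesis
    unfolding alcove_of_def geom_act_cl using GR_rev
    by (metis (no_types, lifting) image_iff subsetI subset_antisym)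
qed

lemma alc_cong:
  assumes "cl u = cl v" shows "alc u = alc v"
  by (simp add: alc_def R_cong[OF assms])

text \<open>The image under \<open>u\<close> of an interior point of the base alcove lies in
  \<open>alc v\<close>. Reading its inequalities back at the base alcove shows that
  \<open>rev u @ v\<close> keeps every simple root positive.\<close>

lemma alc_inject: "alc u = alc v \<longleftrightarrow> cl u = cl v"
proof
  assume eq: "alc u = alc v"
  obtain x where x: "\<And>k. aff (axis k 1) x < 0" using ex_interior_point by blast
  have "GR u x \<in> alc v" using x unfolding eq[symmetric] by (simp add: alc_def aff_GR R_rev less_imp_le)
  then have le: "aff (R (rev u @ v) (axis i 1)) x \<le> 0" for i
    by (simp add: alc_def aff_GR)
  have "nonneg_vec (R (rev u @ v) (axis i 1))" for i
  proof (rule ccontr)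
    assume "\<not> nonneg_vec (R (rev u @ v) (axis i 1))"
    then have "nonneg_vec (- R (rev u @ v) (axis i 1))"
      using root_sign[where x = "rev u @ v" and s = i] by blast
    moreover have "- R (rev u @ v) (axis i 1) \<noteq> 0"
      unfolding neg_equal_0_iff_equal by (rule R_simple_nonzero)
    ultimately have "aff (- R (rev u @ v) (axis i 1)) x < 0" using x by (rule aff_neg)
    then show False using le[of i] by (simp add: aff_minus)
  qed
  then have "cl (rev u @ v) = cl []" by (rule cl_eq_Nil)
  then have "cl (rev u @ v) = cl (rev u @ u)" using cl_rev_append by simp
  then show "cl u = cl v" using cl_cancel_left by blast
qed (rule alc_cong)

section \<open>Group operations and reflections in terms of words\<close>

lemma carrier_iff: "X \<in> carrier (weyl_group A) \<longleftrightarrow> (\<exists>x. X = cl x)"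
  by (auto simp: weyl_group_def quotient_def cl_def)

lemma mult_cl: "cl x \<otimes>\<^bsub>weyl_group A\<^esub> cl y = cl (x @ y)"
  unfolding cl_def by (rule weyl_mult_class)

lemma gen_eq: "gen A i = cl [i]" and one_eq: "\<one>\<^bsub>weyl_group A\<^esub> = cl []"
  by (simp_all add: gen_def cl_def weyl_group_def)

lemma inv_cl: "inv\<^bsub>weyl_group A\<^esub> cl u = cl (rev u)"
  using group_weyl_group
  by (rule group.inv_equality) (auto simp: mult_cl one_eq cl_rev_append carrier_iff)

lemma elt_of_alc: "elt_of A \<theta> (alc u) = cl u"
  unfolding elt_of_def
  by (rule the_equality) (auto simp: carrier_iff alcove_of_cl alc_inject)

lemma real_roots_iff: "\<beta> \<in> real_roots A \<longleftrightarrow> (\<exists>u i. \<beta> = R u (axis i 1))"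
  unfolding real_roots_def mem_Collect_eq carrier_iff using act_cl by metis

lemma reflection_eq: "reflection A (R u (axis i 1)) = cl (u @ [i] @ rev u)"
  unfolding reflection_def
proof (rule the_equality)
  show "\<exists>v j. v \<in> carrier (weyl_group A) \<and> R u (axis i 1) = act A v (axis j 1) \<and>
      cl (u @ [i] @ rev u) = v \<otimes>\<^bsub>weyl_group A\<^esub> gen A j \<otimes>\<^bsub>weyl_group A\<^esub> inv\<^bsub>weyl_group A\<^esub> v"
    by (intro exI[of _ "cl u"] exI[of _ i]) (auto simp: carrier_iff act_cl gen_eq inv_cl mult_cl)
next
  fix r
  assume "\<exists>v j. v \<in> carrier (weyl_group A) \<and> R u (axis i 1) = act A v (axis j 1) \<and>
      r = v \<otimes>\<^bsub>weyl_group A\<^esub> gen A j \<otimes>\<^bsub>weyl_group A\<^esub> inv\<^bsub>weyl_group A\<^esub> v"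
  then obtain v j where "R u (axis i 1) = R v (axis j 1)" and r: "r = cl (v @ [j] @ rev v)"
    by (auto simp: carrier_iff act_cl gen_eq inv_cl mult_cl)
  from root_reflection_unique[OF this(1)] show "r = cl (u @ [i] @ rev u)" unfolding r by (rule sym)
qed

section \<open>Open alcoves as components, and facets\<close>

lemma hyperpl_eq: "hyperpl \<theta> \<beta> = {x. aff \<beta> x = 0}"
  by (auto simp: hyperpl_def aff_def)

lemma aff_segment: "aff \<beta> (y + t *\<^sub>R (z - y)) = (1 - t) * aff \<beta> y + t * aff \<beta> z"
  by (simp add: aff_inner inner_add_right inner_diff_right algebra_simps)

lemma open_alc_nonempty: "open_alc u \<noteq> {}"
proof -
  obtain x where "\<And>k. aff (axis k 1) x < 0" using ex_interior_point by blast
  then have "GR u x \<in> open_alc u" by (simp add: open_alc_def aff_GR R_rev)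
  then show ?thesis by blast
qed

lemma open_aff_neg: "open {x. \<forall>i\<in>J. aff (R u (axis i 1)) x < 0}"
proof -
  have "{x. \<forall>i\<in>J. aff (R u (axis i 1)) x < 0} =
      (\<Inter>i\<in>J. {x. normal (R u (axis i 1)) \<bullet> x < real_of_int (level (R u (axis i 1)))})"
    by (auto simp: aff_inner)
  then show ?thesis by (simp add: open_INT open_halfspace_lt)
qed

lemma open_alc_eq_INT:
  "open_alc u = (\<Inter>i. {x. normal (R u (axis i 1)) \<bullet> x < real_of_int (level (R u (axis i 1)))})"
  by (auto simp: open_alc_def aff_inner)

lemma alc_eq_INT:
  "alc u = (\<Inter>i. {x. normal (R u (axis i 1)) \<bullet> x \<le> real_of_int (level (R u (axis i 1)))})"
  by (auto simp: alc_def aff_inner)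

lemma open_open_alc: "open (open_alc u)" and convex_open_alc: "convex (open_alc u)"
  unfolding open_alc_eq_INT
  by (auto intro!: open_INT convex_INT open_halfspace_lt convex_halfspace_lt)

lemma closed_alc: "closed (alc u)" and convex_alc: "convex (alc u)"
  unfolding alc_eq_INT
  by (auto intro!: closed_INT convex_INT closed_halfspace_le convex_halfspace_le)

lemma open_alc_subset: "open_alc u \<subseteq> alc u"
  by (auto simp: open_alc_def alc_def less_imp_le)

lemma closure_open_alc: "closure (open_alc u) = alc u"
proof
  show "closure (open_alc u) \<subseteq> alc u" using open_alc_subset closed_alc by (rule closure_minimal)
  show "alc u \<subseteq> closure (open_alc u)"
  proof
    fix y assume y: "y \<in> alc u"
    obtain z where z: "z \<in> open_alc u" using open_alc_nonempty by blast
    \<comment> \<open>Moving from \<open>y\<close> towards the interior point \<open>z\<close> makes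
      every inequality strict at once.\<close>
    define h where "h n = y + inverse (real (Suc n)) *\<^sub>R (z - y)" for n
    have "h n \<in> open_alc u" for n
    proof -
      let ?t = "inverse (real (Suc n))"
      have t: "0 < ?t" "?t \<le> 1" by (auto simp: field_simps)
      have "(1 - ?t) * aff (R u (axis i 1)) y + ?t * aff (R u (axis i 1)) z < 0" for i
      proof (rule add_nonpos_neg)
        show "(1 - ?t) * aff (R u (axis i 1)) y \<le> 0"
          using t y by (intro mult_nonneg_nonpos) (auto simp: alc_def)
        show "?t * aff (R u (axis i 1)) z < 0"
          using t z by (intro mult_pos_neg) (auto simp: open_alc_def)
      qed
      then show ?thesis by (simp only: open_alc_def h_def aff_segment mem_Collect_eq simp_thms)
    qed
    moreover have "h \<longlonglongrightarrow> y + 0 *\<^sub>R (z - y)"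
      unfolding h_def by (intro tendsto_intros LIMSEQ_inverse_real_of_nat)
    ultimately show "y \<in> closure (open_alc u)"
      unfolding closure_sequential by auto
  qed
qed

lemma open_alc_component: "open_alc u \<in> components (- (\<Union>\<beta>\<in>real_roots A. hyperpl \<theta> \<beta>))"
  unfolding in_components_maximal
proof (intro conjI allI impI)
  let ?S = "- (\<Union>\<beta>\<in>real_roots A. hyperpl \<theta> \<beta>)"
  show "open_alc u \<noteq> {}" by (rule open_alc_nonempty)
  show "connected (open_alc u)" by (rule convex_connected[OF convex_open_alc])
  have "aff (R v (axis i 1)) x \<noteq> 0" if "x \<in> open_alc u" for x v i
  proof -
    have "aff (axis k 1) (GR (rev u) x) < 0" for k
      using that by (simp add: aff_GR open_alc_def)
    then have "aff (R (rev u @ v) (axis i 1)) (GR (rev u) x) \<noteq> 0" by (rule aff_root_nonzero)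
    then show ?thesis by (simp add: aff_GR R_rev)
  qed
  then show "open_alc u \<subseteq> ?S" by (auto simp: hyperpl_eq real_roots_iff)
  fix d assume d: "d \<noteq> {} \<and> open_alc u \<subseteq> d \<and> d \<subseteq> ?S \<and> connected d"
  \<comment> \<open>As \<open>d\<close> avoids the walls, any of its points outside
    \<open>open_alc u\<close> lies strictly beyond some wall. So \<open>D\<close> and
    \<open>open_alc u\<close> would disconnect \<open>d\<close> if both met it.\<close>
  define D where "D = (\<Union>i. {x. normal (R u (axis i 1)) \<bullet> x > real_of_int (level (R u (axis i 1)))})"
  have open_D: "open D" unfolding D_def by (intro open_UN ballI open_halfspace_gt)
  have nonzero: "aff (R u (axis i 1)) x \<noteq> 0" if "x \<in> d" for x i
  proof -
    have "R u (axis i 1) \<in> real_roots A" unfolding real_roots_iff by blast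
    then show ?thesis using d that unfolding hyperpl_eq by blast
  qed
  have "x \<in> D" if x: "x \<in> d" "x \<notin> open_alc u" for x
  proof -
    obtain i where "\<not> aff (R u (axis i 1)) x < 0" using x(2) by (auto simp: open_alc_def)
    with nonzero[OF x(1), of i] have "0 < aff (R u (axis i 1)) x" by linarith
    then show ?thesis unfolding D_def by (intro UN_I[of i]) (simp_all add: aff_inner)
  qed
  then have cover: "d \<subseteq> open_alc u \<union> D" by blast
  have "x \<notin> D" if "x \<in> open_alc u" for x
    using that unfolding open_alc_eq_INT D_def by (auto simp: not_less less_imp_le)
  then have disj: "open_alc u \<inter> D \<inter> d = {}" by blast
  have "connected d" using d by simp
  from connectedD[OF this open_open_alc open_D disj cover]
  have "D \<inter> d = {}"
  proof
    assume "open_alc u \<inter> d = {}"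
    then show ?thesis using d open_alc_nonempty[of u] by (simp add: Int_absorb2)
  qed
  then show "d = open_alc u" using cover d by blast
qed

lemma alc_in_alcoves: "alc u \<in> alcoves A \<theta>"
  unfolding alcoves_def using open_alc_component closure_open_alc by (metis image_eqI)

text \<open>Near a wall point where all other inequalities are strict, the whole hyperplane stays in
  the alcove; hence the face has codimension one.\<close>

lemma facet_of_alc: "(alc u \<inter> {x. aff (R u (axis i 1)) x = 0}) facet_of alc u"
proof -
  let ?a = "normal (R u (axis i 1))" and ?b = "real_of_int (level (R u (axis i 1)))"
  let ?H = "{x. ?a \<bullet> x = ?b}"
  have H: "{x. aff (R u (axis i 1)) x = 0} = ?H" by (simp add: aff_inner)
  have face: "(alc u \<inter> ?H) face_of alc u"
    by (rule face_of_Int_supporting_hyperplane_le[OF convex_alc]) (simp add: alc_def aff_inner)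
  have "interior (alc u) \<noteq> {}"
    using interior_maximal[OF open_alc_subset open_open_alc] open_alc_nonempty by blast
  then have dim: "aff_dim (alc u) = int DIM(real^'i)" by (rule aff_dim_nonempty_interior)
  obtain z where z: "aff (axis i 1) z = 0" "\<And>k. k \<noteq> i \<Longrightarrow> aff (axis k 1) z < 0"
    using ex_wall_point by blast
  let ?O = "{x. \<forall>k\<in>- {i}. aff (R u (axis k 1)) x < 0}"
  have zH: "GR u z \<in> ?H \<inter> ?O" using z by (simp add: aff_GR R_rev flip: H)
  have sub: "?H \<inter> ?O \<subseteq> alc u \<inter> ?H"
  proof -
    have "aff (R u (axis k 1)) x \<le> 0" if "x \<in> ?H \<inter> ?O" for x k
      using that by (cases "k = i") (auto simp: less_imp_le simp flip: H)
    then show ?thesis by (auto simp: alc_def)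
  qed
  \<comment> \<open>With zero normal, the wall point would give \<open>?b = 0\<close> and an
    interior point \<open>0 < ?b\<close>.\<close>
  have "?a \<noteq> 0"
  proof
    assume "?a = 0"
    obtain x where "x \<in> open_alc u" using open_alc_nonempty by blast
    then have "?a \<bullet> x < ?b" by (simp add: open_alc_eq_INT)
    then show False using zH \<open>?a = 0\<close> by simp
  qed
  then have dimH: "aff_dim ?H = int DIM(real^'i) - 1"
    by (subst aff_dim_hyperplane) (simp_all add: of_nat_diff Suc_leI)
  have "aff_dim (?H \<inter> ?O) = aff_dim ?H"
    using zH by (intro aff_dim_convex_Int_open convex_hyperplane open_aff_neg) blast
  then have "aff_dim ?H \<le> aff_dim (alc u \<inter> ?H)" using aff_dim_subset[OF sub] by simp
  moreover have "aff_dim (alc u \<inter> ?H) \<le> aff_dim ?H" by (rule aff_dim_subset) blast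
  ultimately have "aff_dim (alc u \<inter> ?H) = aff_dim (alc u) - 1" using dim dimH by simp
  moreover have "alc u \<inter> ?H \<noteq> {}" using zH sub by blast
  ultimately show ?thesis using face unfolding facet_of_def H by blast
qed

text \<open>The reflection changes each root by a multiple of the simple root of \<open>i\<close>,
  whose image under \<open>u\<close> vanishes on the wall.\<close>

lemma alc_snoc_wall:
  "alc (u @ [i]) \<inter> {x. aff (R u (axis i 1)) x = 0} = alc u \<inter> {x. aff (R u (axis i 1)) x = 0}"
  by (auto simp: alc_def simple_refl_simple R_diff R_scale aff_diff aff_scale)

lemma common_facet: "\<exists>F. F facet_of alc u \<and> F facet_of alc (u @ [i])"
proof -
  have "{x. aff (R (u @ [i]) (axis i 1)) x = 0} = {x. aff (R u (axis i 1)) x = 0}"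
    unfolding R_snoc_simple by (simp add: aff_minus)
  then show ?thesis using facet_of_alc[of u i] facet_of_alc[of "u @ [i]" i] alc_snoc_wall by metis
qed

lemma alc_snoc_neq: "alc u \<noteq> alc (u @ [i])"
  unfolding alc_inject using parity_invariant[of u "u @ [i]"] by auto

section \<open>Walks\<close>

text \<open>The walk through the prefixes shows that every word is the type of a walk, so the choice
  in \<open>psi\<close> does select one.\<close>

lemma ex_alcove_walk: "alcove_walk A \<theta> (map (\<lambda>j. alc (take j ks)) [0..<Suc (length ks)]) ks (cl ks)"
proof -
  have n: "map (\<lambda>j. alc (take j ks)) [0..<Suc (length ks)] ! j = alc (take j ks)" if "j \<le> length ks" for j
    using that nth_map[of j "[0..<Suc (length ks)]"] by (simp del: upt_Suc)
  have "\<exists>v\<in>carrier (weyl_group A). alc (take j ks) = alcove_of A \<theta> v \<and>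
      alc (take (Suc j) ks) = alcove_of A \<theta> (v \<otimes>\<^bsub>weyl_group A\<^esub> gen A (ks ! j))" if "j < length ks" for j
    using that
    by (intro bexI[of _ "cl (take j ks)"])
      (auto simp: carrier_iff gen_eq mult_cl alcove_of_cl take_Suc_conv_app_nth)
  then show ?thesis
    using alc_snoc_neq common_facet alc_in_alcoves
    unfolding alcove_walk_def
    by (simp add: n base_alcove_eq alcove_of_cl del: upt_Suc)
      (auto simp: take_Suc_conv_app_nth n base_alcove_eq simp del: upt_Suc)
qed

text \<open>A walk only provides some group element at each step; injectivity of alcoves identifies
  it with the prefix read so far.\<close>

lemma alcove_walk_nth:
  assumes "alcove_walk A \<theta> \<gamma> ks w" "j \<le> length ks"
  shows "\<gamma> ! j = alc (take j ks)"
  using assms(2)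
proof (induction j)
  case 0
  then show ?case using assms(1) by (simp add: alcove_walk_def base_alcove_eq)
next
  case (Suc j)
  have "\<forall>j<length ks. \<exists>v\<in>carrier (weyl_group A). \<gamma> ! j = alcove_of A \<theta> v \<and>
      \<gamma> ! Suc j = alcove_of A \<theta> (v \<otimes>\<^bsub>weyl_group A\<^esub> gen A (ks ! j))"
    using assms(1) by (simp add: alcove_walk_def)
  then obtain v where "v \<in> carrier (weyl_group A)" "\<gamma> ! j = alcove_of A \<theta> v"
    "\<gamma> ! Suc j = alcove_of A \<theta> (v \<otimes>\<^bsub>weyl_group A\<^esub> gen A (ks ! j))"
    using Suc.prems by (meson Suc_le_lessD)
  then obtain k where k: "alc (take j ks) = alc k" "\<gamma> ! Suc j = alc (k @ [ks ! j])"
    using Suc by (auto simp: carrier_iff gen_eq mult_cl alcove_of_cl)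
  have "cl (take j ks) = cl k" using k(1) by (simp only: alc_inject)
  from cl_append_cong[OF this refl] have "cl (take j ks @ [ks ! j]) = cl (k @ [ks ! j])" .
  from alc_cong[OF this] show ?case using k(2) Suc.prems by (simp add: take_Suc_conv_app_nth)
qed

lemma alcove_walk_end:
  assumes "alcove_walk A \<theta> \<gamma> ks (cl k)" shows "cl ks = cl k"
proof -
  have "alc ks = alcove_of A \<theta> (cl k)"
    using alcove_walk_nth[OF assms, of "length ks"] assms by (simp add: alcove_walk_def)
  then show ?thesis by (simp only: alcove_of_cl alc_inject)
qed

lemma step_label_eq:
  assumes "alcove_walk A \<theta> \<gamma> ks w" "j < length ks"
  shows "step_label A \<theta> \<gamma> ks j = R (take j ks) (axis (ks ! j) 1)"
proof -
  let ?u = "take j ks" and ?i = "ks ! j"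
  let ?\<beta> = "R ?u (axis ?i 1)"
  have pos: "?\<beta> \<in> pos_roots A" if "nonneg_vec ?\<beta>"
    using that unfolding pos_roots_def by (auto simp: real_roots_iff nonneg_vec_def)
  have neg: "?\<beta> \<in> neg_roots A" if "nonneg_vec (- ?\<beta>)"
  proof -
    have "- ?\<beta> \<in> real_roots A" unfolding real_roots_iff R_snoc_simple[symmetric] by blast
    then have "- ?\<beta> \<in> pos_roots A" using that by (auto simp: pos_roots_def nonneg_vec_def)
    then show ?thesis unfolding neg_roots_def by (metis add.inverse_inverse image_eqI)
  qed
  show ?thesis
    using alcove_walk_nth[OF assms(1), of j] assms(2) pos neg
      nonneg_if_L_less[where x = ?u and s = ?i] nonpos_if_L_less[where x = ?u and s = ?i]
    by (cases rule: L_snoc_cases[where x = ?u and i = ?i])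
      (auto simp: step_label_def Let_def elt_of_alc act_cl gen_eq mult_cl)
qed

lemma subword_elt_eq: "length \<epsilon> = length ks \<Longrightarrow> subword_elt A ks \<epsilon> = cl (masked ks \<epsilon>)"
  unfolding subword_elt_def masked_def
  by (induction \<epsilon> ks rule: list_induct2) (auto simp: one_eq gen_eq mult_cl)

lemma count_list_masked: "length \<epsilon> = length ks \<Longrightarrow> count_list \<epsilon> True = length (masked ks \<epsilon>)"
  unfolding masked_def by (induction \<epsilon> ks rule: list_induct2) auto

lemma psi_walk_eq:
  assumes "alcove_walk A \<theta> \<gamma> ks w"
  shows "psi_walk A \<theta> (cl x) \<gamma> ks = mask_sum ks x"
  unfolding psi_walk_def mask_sum_def
proof (rule sum.cong)
  show "{\<epsilon>. length \<epsilon> = length ks \<and> count_list \<epsilon> True = L x \<and> subword_elt A ks \<epsilon> = cl x} = masks ks x"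
    by (simp add: masks_def subword_elt_eq count_list_masked cong: conj_cong)
  show "mask_pol A \<theta> \<gamma> ks \<epsilon> = weight ks \<epsilon>" for \<epsilon>
    unfolding mask_pol_def weight_def label_pol_def
    by (rule prod.cong) (auto simp: step_label_eq[OF assms])
qed

theorem psi_eq: "psi A \<theta> (cl x) (cl k) = mask_sum k x"
proof -
  obtain \<gamma> ks where s: "(SOME (\<gamma>, ks). alcove_walk A \<theta> \<gamma> ks (cl k)) = (\<gamma>, ks)" by fastforce
  have "case (SOME (\<gamma>, ks). alcove_walk A \<theta> \<gamma> ks (cl k)) of (\<gamma>, ks) \<Rightarrow> alcove_walk A \<theta> \<gamma> ks (cl k)"
    by (rule someI_ex) (use ex_alcove_walk in auto)
  then have walk: "alcove_walk A \<theta> \<gamma> ks (cl k)" by (simp add: s)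
  show ?thesis
    using psi_walk_eq[OF walk] mask_sum_word_cong[OF alcove_walk_end[OF walk]] by (simp add: psi_def s)
qed

end

theorem theorem4p1:
  fixes A :: "int^('i::finite option)^('i option)" and \<theta> :: "int^'i"
    and v w :: "'i option list set" and \<beta> :: "int^('i option)"
  assumes "affine_cartan_datum A \<theta>"
    and "v \<in> carrier (weyl_group A)" and "w \<in> carrier (weyl_group A)"
    and "\<beta> \<in> real_roots A"
  shows "(\<forall>\<gamma> ks. alcove_walk A \<theta> \<gamma> ks w \<longrightarrow> psi_walk A \<theta> v \<gamma> ks = psi A \<theta> v w) \<and>
    root_pol \<beta> dvd psi A \<theta> v w - psi A \<theta> v (reflection A \<beta> \<otimes>\<^bsub>weyl_group A\<^esub> w)"
proof -
  have gcm: "gcm A" using assms(1) by (simp add: affine_cartan_datum_def)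
  interpret fin: gcm_words "fin_matrix A"
    by unfold_locales (use gcm in \<open>auto simp: gcm_def fin_matrix_def\<close>)
  \<comment> \<open>The highest root dominates every simple root, which gives the positivity of the
    coefficients of \<open>\<theta>\<close>.\<close>
  have simple: "simple_root j \<in> real_roots (fin_matrix A)" for j
  proof -
    have "simple_root j = act (fin_matrix A) (fin.cl []) (simple_root j)"
      by (simp add: fin.act_cl)
    moreover have "fin.cl [] \<in> carrier (weyl_group (fin_matrix A))"
      by (simp add: weyl_group_def quotient_def fin.cl_def) blast
    ultimately show ?thesis unfolding real_roots_def by blast
  qed
  interpret affine_words A \<theta>
  proof unfold_locales
    show "gcm A" by (rule gcm)
    show "A *v delta \<theta> = 0" using assms(1) by (simp add: affine_cartan_datum_def)
    have "\<forall>\<beta>\<in>real_roots (fin_matrix A). \<forall>i. \<beta> $ i \<le> \<theta> $ i"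
      using assms(1) by (simp add: affine_cartan_datum_def highest_root_def)
    then have "simple_root j $ j \<le> \<theta> $ j" for j using simple by blast
    then show "1 \<le> \<theta> $ j" for j by (simp add: axis_def)
  qed
  obtain x k where vw: "v = cl x" "w = cl k" using assms(2,3) by (auto simp: carrier_iff)
  obtain u i where \<beta>: "\<beta> = R u (axis i 1)" using assms(4) by (auto simp: real_roots_iff)
  have "psi_walk A \<theta> v \<gamma> ks = psi A \<theta> v w" if "alcove_walk A \<theta> \<gamma> ks w" for \<gamma> ks
    using psi_walk_eq[OF that] mask_sum_word_cong[of ks k] alcove_walk_end[of \<gamma> ks k] that
    by (simp add: vw psi_eq)
  moreover have "root_pol \<beta> dvd mask_sum k x - mask_sum ((u @ [i] @ rev u) @ k) x"
  proof -
    \<comment> \<open>Inserting a cancelling pair before \<open>k\<close> makes the words for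
      \<open>w\<close> and its reflection differ by the single letter \<open>i\<close>.\<close>
    have "cl (u @ rev u @ k) = cl k"
      using cl_append_cong[OF cl_rev_append(2) refl, of u k] by simp
    then have "mask_sum (u @ rev u @ k) = mask_sum k" by (rule mask_sum_word_cong)
    then show ?thesis using mask_sum_reflection[of u i "rev u @ k" x] by (simp add: \<beta> label_pol_def)
  qed
  ultimately show ?thesis by (simp only: vw \<beta> reflection_eq mult_cl psi_eq) blast
qed

end
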